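(* Let $\mathcal{C}$ be a cartesian Rosický tangent category with scalar $R$-multiplication, and let $X\in\mathcal{C}$. Then the Leibniz rule $$[v,fw]=(v\cdot f)\,w+f\,[v,w]$$ holds for all vector fields $v,w\in\Gamma(X,TX)$ and all functions $f:X\to R$.
   Context: **Rosický tangent structure.** A Rosický tangent structure on a category $\mathcal{C}$ consists of a functor $T:\mathcal{C}\to\mathcal{C}$ and natural transformations $\pi:T\to 1$, $0:1\to T$, $+:T_2\to T$, $\lambda:T\to T^2$, $\tau:T^2\to T^2$ such that for all objects $X$: (i) for all $k\ge1$ the fiber product $T_kX=TX\times_X\cdots\times_XTX$ of $k$ copies of $\pi_X:TX\to X$ exists and is preserved by $T$, i.e. the natural morphism $\nu_{k,X}:T(T_kX)\to T^2X\times_{TX}^{T\pi_X,T\pi_X}\cdots\times_{TX}^{T\pi_X,T\pi_X}T^2X$ is an isomorphism; (ii) $\pi_X:TX\to X$ with addition $+_X$ and zero $0_X$ is an abelian group object in the slice category $\mathcal{C}_{/X}$; let $-_X:T_2X\to TX$ denote the fiberwise difference; (iii) $\tau_X\circ\tau_X=\mathrm{id}$, $\tau_{TX}\circ T\tau_X\circ\tau_{TX}=T\tau_X\circ\tau_{TX}\circ T\tau_X$, $\pi_{TX}\circ\tau_X=T\pi_X$, and $+_{TX}\circ(\tau_X\times_{TX}\tau_X)=\tau_X\circ T(+_X)\circ\nu_{2,X}^{-1}$ on $T^2X\times_{TX}^{T\pi_X,T\pi_X}T^2X$; (iv) $\pi_{TX}\circ\lambda_X=0_X\circ\pi_X$,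 $\lambda_{TX}\circ\lambda_X=T\lambda_X\circ\lambda_X$, and $+_{TX}\circ(\lambda_X\times_{0_X}\lambda_X)=\lambda_X\circ+_X$; (v) $\tau_X\circ\lambda_X=\lambda_X$ and $T\tau_X\circ\tau_{TX}\circ T\lambda_X=\lambda_{TX}\circ\tau_X$; (vi) the commutative square $(\pi_{TX},T\pi_X)\circ\lambda_X=(0_X,0_X)\circ\pi_X:TX\to T_2X$ is a pullback square. The extended vertical lift is $(\lambda_2)_X:=\tau_X\circ+_{TX}\circ(T0_X\times_{0_X}\lambda_X):T_2X\to T^2X$. It is known that the square with $(\lambda_2)_X$, $T\pi_X:T^2X\to TX$, $\pi_X\circ\mathrm{pr}_1:T_2X\to X$ and $0_X:X\to TX$ is a pullback. **Cartesian.** The tangent structure is cartesian if $\mathcal{C}$ has finite products and $\chi_{X,Y}:=(T\mathrm{pr}_1,T\mathrm{pr}_2):T(X\times Y)\to TX\times TY$ is invertible for all $X,Y$. For $f:X\times Y\to Z$ the partial tangent morphisms are $T_{(1)}f:=Tf\circ\chi_{X,Y}^{-1}\circ(\mathrm{id}_{TX}\times0_Y):TX\times Y\to TZ$ and $T_{(2)}f:=Tf\circ\chi_{X,Y}^{-1}\circ(0_X\times\mathrm{id}_{TY}):X\times TY\to TZ$. **Vector fields.** A vector field on $X$ is a section $v:X\to TX$ of $\pi_X$; $\Gamma(X,TX)$ denotes the set of them, with sum $v+w:=+_X\circ(v,w)$. The bracket $[v,w]$ is the unique vector field with $\delta(v,w)=(\lambda_2)_X\circ(w,[v,w])$, where $\delta(v,w):=-_{TX}\circ(Tw\circ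 v,\ \tau_X\circ Tv\circ w):X\to T^2X$. It is known that this is a Lie bracket. **Scalar multiplication.** Let $R$ be a commutative unital ring object in $\mathcal{C}$ with addition $\hat{+}$, zero $\hat{0}$, multiplication $\hat{m}$, unit $\hat{1}$. An $R$-module structure on the tangent bundle is a natural morphism $\kappa_X:R\times TX\to TX$ with $\pi_X\circ\kappa_X=\pi_X\circ\mathrm{pr}_2$, $\kappa_X\circ(\mathrm{id}_R\times\kappa_X)=\kappa_X\circ(\hat{m}\times\mathrm{id}_{TX})$, $\kappa_X\circ(\hat{1}\times\mathrm{id}_{TX})$ equal to the canonical isomorphism $*\times TX\cong TX$, $\kappa_X\circ(\hat{+}\times\mathrm{id}_{TX})=+_X\circ(\kappa_X\circ(\mathrm{pr}_1,\mathrm{pr}_3),\kappa_X\circ(\mathrm{pr}_2,\mathrm{pr}_3))$, and $\kappa_X\circ(\mathrm{id}_R\times+_X)=+_X\circ(\kappa_X\circ(\mathrm{pr}_1,\mathrm{pr}_2),\kappa_X\circ(\mathrm{pr}_1,\mathrm{pr}_3))$ on $R\times T_2X$. The tangent fiber $T_{\hat{0}}R:=*\times_R^{\hat{0},\pi_R}TR$ (if it exists) inherits an $R$-module structure from $+_R,0_R,\kappa_R$. $R$ is tangent-stable if $T_{\hat{0}}R$ exists and there is an isomorphism of $R$-modules $T_{\hat{0}}R\cong R$, which is then fixed. In that case $\eta_R:TR\to R$ is the projection onto the fiber: the morphism $T_{(2)}\hat{+}\circ(\hat{\iota}\circ\pi_R,\mathrm{id}_{TR}):TR\to TR$ (with $\hat{\iota}$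 the additive inverse of $R$) factors uniquely through $T_{\hat{0}}R\to TR$, and $\eta_R$ is the resulting $TR\to T_{\hat{0}}R$ followed by $T_{\hat{0}}R\cong R$. The $R$-module structure $\kappa$ is a scalar $R$-multiplication if $R$ is tangent-stable and for all $X$: (S1) $\lambda_X\circ\kappa_X=\kappa_{TX}\circ(\mathrm{id}_R\times\lambda_X)$; (S2) $T_{(1)}\kappa_X=(\lambda_2)_X\circ(\kappa_X\circ(\mathrm{pr}_1,\mathrm{pr}_3),\kappa_X\circ(\mathrm{pr}_2,\mathrm{pr}_3))\circ((\pi_R,\eta_R)\times\mathrm{id}_{TX})$ on $TR\times TX$; (S3) $T_{(2)}\kappa_X=\tau_X\circ\kappa_{TX}\circ(\mathrm{id}_R\times\tau_X)$ on $R\times T^2X$. **Functions.** $\mathrm{Hom}(X,R)$ is a commutative ring with $f+g:=\hat{+}\circ(f,g)$ and $fg:=\hat{m}\circ(f,g)$. Vector fields act on functions by $v\cdot f:=\eta_R\circ Tf\circ v$, and functions multiply vector fields by $fv:=\kappa_X\circ(f,v)$. *)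

theory Defs
  imports Main
begin

section \<open>Categories and limits\<close>

record ('o, 'm) category_data =
  Ob :: "'o set"
  Ar :: "'m set"
  Dom :: "'m \<Rightarrow> 'o"
  Cod :: "'m \<Rightarrow> 'o"
  Idn :: "'o \<Rightarrow> 'm"
  Comp :: "'m \<Rightarrow> 'm \<Rightarrow> 'm" (infixr "\<cdot>\<index>" 70)

definition Hom :: "('o, 'm, 'z) category_data_scheme \<Rightarrow> 'o \<Rightarrow> 'o \<Rightarrow> 'm set" where
  "Hom C X Y = {f \<in> Ar C. Dom C f = X \<and> Cod C f = Y}"

locale category =
  fixes C :: "('o, 'm, 'z) category_data_scheme" (structure)
  assumes dom_cod: "f \<in> Ar C \<Longrightarrow> Dom C f \<in> Ob C \<and> Cod C f \<in> Ob C"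
    and idn: "X \<in> Ob C \<Longrightarrow> Idn C X \<in> Hom C X X"
    and comp: "\<lbrakk>f \<in> Hom C X Y; g \<in> Hom C Y Z\<rbrakk> \<Longrightarrow> g \<cdot> f \<in> Hom C X Z"
    and comp_idn: "f \<in> Hom C X Y \<Longrightarrow> f \<cdot> Idn C X = f"
    and idn_comp: "f \<in> Hom C X Y \<Longrightarrow> Idn C Y \<cdot> f = f"
    and comp_assoc: "\<lbrakk>f \<in> Hom C W X; g \<in> Hom C X Y; h \<in> Hom C Y Z\<rbrakk>
      \<Longrightarrow> h \<cdot> (g \<cdot> f) = (h \<cdot> g) \<cdot> f"

definition is_inverse :: "('o, 'm, 'z) category_data_scheme \<Rightarrow> 'm \<Rightarrow> 'm \<Rightarrow> bool" where
  "is_inverse C f g \<longleftrightarrow> f \<in> Ar C \<and> g \<in> Hom C (Cod C f) (Dom C f) \<and>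
     g \<cdot> f = Idn C (Dom C f) \<and> f \<cdot> g = Idn C (Cod C f)"
  for C (structure)

definition is_iso :: "('o, 'm, 'z) category_data_scheme \<Rightarrow> 'm \<Rightarrow> bool" where
  "is_iso C f \<longleftrightarrow> (\<exists>g. is_inverse C f g)"

definition inv_of :: "('o, 'm, 'z) category_data_scheme \<Rightarrow> 'm \<Rightarrow> 'm" where
  "inv_of C f = (THE g. is_inverse C f g)"

text \<open>The object \<open>P\<close> with \<open>p : P \<rightarrow> Dom f\<close> and \<open>q : P \<rightarrow> Dom g\<close> is a pullback of \<open>f\<close> and \<open>g\<close>.\<close>

definition is_pullback ::
  "('o, 'm, 'z) category_data_scheme \<Rightarrow> 'm \<Rightarrow> 'm \<Rightarrow> 'o \<Rightarrow> 'm \<Rightarrow> 'm \<Rightarrow> bool" where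
  "is_pullback C f g P p q \<longleftrightarrow>
     f \<in> Ar C \<and> g \<in> Ar C \<and> Cod C f = Cod C g \<and> P \<in> Ob C \<and>
     p \<in> Hom C P (Dom C f) \<and> q \<in> Hom C P (Dom C g) \<and> f \<cdot> p = g \<cdot> q \<and>
     (\<forall>Z\<in>Ob C. \<forall>a\<in>Hom C Z (Dom C f). \<forall>b\<in>Hom C Z (Dom C g). f \<cdot> a = g \<cdot> b \<longrightarrow>
        (\<exists>!u. u \<in> Hom C Z P \<and> p \<cdot> u = a \<and> q \<cdot> u = b))"
  for C (structure)

text \<open>The object \<open>P\<close> with projections \<open>q 0, \<dots>, q (k - 1)\<close> is a fiber product of \<open>k\<close> copies
  of \<open>p\<close> over \<open>Cod p\<close>. This is only meant for \<open>k \<ge> 1\<close>.\<close>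

definition is_fiber_power ::
  "('o, 'm, 'z) category_data_scheme \<Rightarrow> 'm \<Rightarrow> nat \<Rightarrow> 'o \<Rightarrow> (nat \<Rightarrow> 'm) \<Rightarrow> bool" where
  "is_fiber_power C p k P q \<longleftrightarrow>
     p \<in> Ar C \<and> P \<in> Ob C \<and>
     (\<forall>i<k. q i \<in> Hom C P (Dom C p)) \<and> (\<forall>i<k. \<forall>j<k. p \<cdot> q i = p \<cdot> q j) \<and>
     (\<forall>Z\<in>Ob C. \<forall>h. (\<forall>i<k. h i \<in> Hom C Z (Dom C p)) \<and> (\<forall>i<k. \<forall>j<k. p \<cdot> h i = p \<cdot> h j) \<longrightarrow>
        (\<exists>!u. u \<in> Hom C Z P \<and> (\<forall>i<k. q i \<cdot> u = h i)))"
  for C (structure)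

definition fiber_tuple ::
  "('o, 'm, 'z) category_data_scheme \<Rightarrow> nat \<Rightarrow> 'o \<Rightarrow> (nat \<Rightarrow> 'm) \<Rightarrow> 'o \<Rightarrow> (nat \<Rightarrow> 'm) \<Rightarrow> 'm" where
  "fiber_tuple C k P q Z h = (THE u. u \<in> Hom C Z P \<and> (\<forall>i<k. q i \<cdot> u = h i))"
  for C (structure)


section \<open>Tangent structures\<close>

text \<open>
  The fiber products \<open>T\<^sub>k X\<close> are carried as chosen data: \<open>Tpow k X\<close> is the object and
  \<open>Tpr k X 0, \<dots>, Tpr k X (k - 1)\<close> are its projections. Natural transformations are given by
  their components: \<open>\<pi>\<close> is the bundle projection, \<open>\<zeta>\<close> the zero section, \<open>\<alpha>\<close> the fiberwise
  addition, \<open>\<ell>\<close> the vertical lift and \<open>\<tau>\<close> the symmetric structure.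
\<close>

record ('o, 'm) tangent_data = "('o, 'm) category_data" +
  Tob :: "'o \<Rightarrow> 'o"
  Tar :: "'m \<Rightarrow> 'm"
  Tpow :: "nat \<Rightarrow> 'o \<Rightarrow> 'o"
  Tpr :: "nat \<Rightarrow> 'o \<Rightarrow> nat \<Rightarrow> 'm"
  bundle_proj :: "'o \<Rightarrow> 'm" ("\<pi>\<index>")
  zero_section :: "'o \<Rightarrow> 'm" ("\<zeta>\<index>")
  fiber_add :: "'o \<Rightarrow> 'm" ("\<alpha>\<index>")
  vert_lift :: "'o \<Rightarrow> 'm" ("\<ell>\<index>")
  sym_flip :: "'o \<Rightarrow> 'm" ("\<tau>\<index>")

text \<open>The morphism \<open>(f, g)\<close> into \<open>T\<^sub>2 X\<close>. The object \<open>X\<close> is an argument because it is not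
  determined by \<open>T X\<close>.\<close>

definition tpair :: "('o, 'm, 'z) tangent_data_scheme \<Rightarrow> 'o \<Rightarrow> 'm \<Rightarrow> 'm \<Rightarrow> 'm" where
  "tpair C X f g = (THE u. u \<in> Hom C (Dom C f) (Tpow C 2 X) \<and>
     Tpr C 2 X 0 \<cdot> u = f \<and> Tpr C 2 X 1 \<cdot> u = g)"
  for C (structure)

text \<open>The comparison \<open>\<nu>\<^sub>k\<^sub>,\<^sub>X\<close> from \<open>T (T\<^sub>k X)\<close> to a fiber product \<open>(P, q)\<close> of \<open>k\<close> copies of
  \<open>T \<pi>\<^sub>X\<close>.\<close>

definition nu :: "('o, 'm, 'z) tangent_data_scheme \<Rightarrow> nat \<Rightarrow> 'o \<Rightarrow> 'o \<Rightarrow> (nat \<Rightarrow> 'm) \<Rightarrow> 'm" where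
  "nu C k X P q = fiber_tuple C k P q (Tob C (Tpow C k X)) (\<lambda>i. Tar C (Tpr C k X i))"

text \<open>
  The group object axioms in the slice over \<open>X\<close>, where the binary and ternary products of
  \<open>\<pi>\<^sub>X\<close> with itself are \<open>T\<^sub>2 X\<close> and \<open>T\<^sub>3 X\<close> and the terminal object is the identity of \<open>X\<close>.
\<close>

definition is_fiber_neg :: "('o, 'm, 'z) tangent_data_scheme \<Rightarrow> 'o \<Rightarrow> 'm \<Rightarrow> bool" where
  "is_fiber_neg C X n \<longleftrightarrow> n \<in> Hom C (Tob C X) (Tob C X) \<and> \<pi> X \<cdot> n = \<pi> X \<and>
     \<alpha> X \<cdot> tpair C X n (Idn C (Tob C X)) = \<zeta> X \<cdot> \<pi> X"
  for C (structure)

definition abelian_group_bundle :: "('o, 'm, 'z) tangent_data_scheme \<Rightarrow> 'o \<Rightarrow> bool" where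
  "abelian_group_bundle C X \<longleftrightarrow>
     \<pi> X \<cdot> \<alpha> X = \<pi> X \<cdot> Tpr C 2 X 0 \<and>
     \<pi> X \<cdot> \<zeta> X = Idn C X \<and>
     \<alpha> X \<cdot> tpair C X (\<alpha> X \<cdot> tpair C X (Tpr C 3 X 0) (Tpr C 3 X 1)) (Tpr C 3 X 2)
       = \<alpha> X \<cdot> tpair C X (Tpr C 3 X 0) (\<alpha> X \<cdot> tpair C X (Tpr C 3 X 1) (Tpr C 3 X 2)) \<and>
     \<alpha> X \<cdot> tpair C X (Tpr C 2 X 1) (Tpr C 2 X 0) = \<alpha> X \<and>
     \<alpha> X \<cdot> tpair C X (\<zeta> X \<cdot> \<pi> X) (Idn C (Tob C X)) = Idn C (Tob C X) \<and>
     (\<exists>n. is_fiber_neg C X n)"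
  for C (structure)

locale tangent_category = category C
  for C :: "('o, 'm, 'z) tangent_data_scheme" (structure) +
  assumes Tob: "X \<in> Ob C \<Longrightarrow> Tob C X \<in> Ob C"
    and Tar: "f \<in> Hom C X Y \<Longrightarrow> Tar C f \<in> Hom C (Tob C X) (Tob C Y)"
    and Tar_idn: "X \<in> Ob C \<Longrightarrow> Tar C (Idn C X) = Idn C (Tob C X)"
    and Tar_comp: "\<lbrakk>f \<in> Hom C X Y; g \<in> Hom C Y Z\<rbrakk> \<Longrightarrow> Tar C (g \<cdot> f) = Tar C g \<cdot> Tar C f"
    and bundle_proj: "X \<in> Ob C \<Longrightarrow> \<pi> X \<in> Hom C (Tob C X) X"
    and bundle_proj_natural: "f \<in> Hom C X Y \<Longrightarrow> \<pi> Y \<cdot> Tar C f = f \<cdot> \<pi> X"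
    and zero_section: "X \<in> Ob C \<Longrightarrow> \<zeta> X \<in> Hom C X (Tob C X)"
    and zero_section_natural: "f \<in> Hom C X Y \<Longrightarrow> \<zeta> Y \<cdot> f = Tar C f \<cdot> \<zeta> X"
    and fiber_add: "X \<in> Ob C \<Longrightarrow> \<alpha> X \<in> Hom C (Tpow C 2 X) (Tob C X)"
    and fiber_add_natural: "f \<in> Hom C X Y \<Longrightarrow>
      \<alpha> Y \<cdot> tpair C Y (Tar C f \<cdot> Tpr C 2 X 0) (Tar C f \<cdot> Tpr C 2 X 1) = Tar C f \<cdot> \<alpha> X"
    and vert_lift: "X \<in> Ob C \<Longrightarrow> \<ell> X \<in> Hom C (Tob C X) (Tob C (Tob C X))"
    and vert_lift_natural: "f \<in> Hom C X Y \<Longrightarrow> \<ell> Y \<cdot> Tar C f = Tar C (Tar C f) \<cdot> \<ell> X"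
    and sym_flip: "X \<in> Ob C \<Longrightarrow> \<tau> X \<in> Hom C (Tob C (Tob C X)) (Tob C (Tob C X))"
    and sym_flip_natural: "f \<in> Hom C X Y \<Longrightarrow>
      \<tau> Y \<cdot> Tar C (Tar C f) = Tar C (Tar C f) \<cdot> \<tau> X"
    and Tpow: "\<lbrakk>X \<in> Ob C; k \<ge> 1\<rbrakk> \<Longrightarrow> is_fiber_power C (\<pi> X) k (Tpow C k X) (Tpr C k X)"
    and Tpow_preserved: "\<lbrakk>X \<in> Ob C; k \<ge> 1\<rbrakk> \<Longrightarrow>
      \<exists>P q. is_fiber_power C (Tar C (\<pi> X)) k P q \<and> is_iso C (nu C k X P q)"
    and group_bundle: "X \<in> Ob C \<Longrightarrow> abelian_group_bundle C X"
    and flip_flip: "X \<in> Ob C \<Longrightarrow> \<tau> X \<cdot> \<tau> X = Idn C (Tob C (Tob C X))"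
    and flip_braid: "X \<in> Ob C \<Longrightarrow>
      \<tau> (Tob C X) \<cdot> Tar C (\<tau> X) \<cdot> \<tau> (Tob C X) = Tar C (\<tau> X) \<cdot> \<tau> (Tob C X) \<cdot> Tar C (\<tau> X)"
    and proj_flip: "X \<in> Ob C \<Longrightarrow> \<pi> (Tob C X) \<cdot> \<tau> X = Tar C (\<pi> X)"
    and add_flip: "\<lbrakk>X \<in> Ob C; is_fiber_power C (Tar C (\<pi> X)) 2 P q\<rbrakk> \<Longrightarrow>
      \<alpha> (Tob C X) \<cdot> tpair C (Tob C X) (\<tau> X \<cdot> q 0) (\<tau> X \<cdot> q 1)
        = \<tau> X \<cdot> Tar C (\<alpha> X) \<cdot> inv_of C (nu C 2 X P q)"
    and proj_lift: "X \<in> Ob C \<Longrightarrow> \<pi> (Tob C X) \<cdot> \<ell> X = \<zeta> X \<cdot> \<pi> X"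
    and lift_lift: "X \<in> Ob C \<Longrightarrow> \<ell> (Tob C X) \<cdot> \<ell> X = Tar C (\<ell> X) \<cdot> \<ell> X"
    and add_lift: "X \<in> Ob C \<Longrightarrow>
      \<alpha> (Tob C X) \<cdot> tpair C (Tob C X) (\<ell> X \<cdot> Tpr C 2 X 0) (\<ell> X \<cdot> Tpr C 2 X 1) = \<ell> X \<cdot> \<alpha> X"
    and flip_lift: "X \<in> Ob C \<Longrightarrow> \<tau> X \<cdot> \<ell> X = \<ell> X"
    and flip_lift_braid: "X \<in> Ob C \<Longrightarrow>
      Tar C (\<tau> X) \<cdot> \<tau> (Tob C X) \<cdot> Tar C (\<ell> X) = \<ell> (Tob C X) \<cdot> \<tau> X"
    and lift_pullback: "X \<in> Ob C \<Longrightarrow>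
      is_pullback C (tpair C X (\<pi> (Tob C X)) (Tar C (\<pi> X))) (tpair C X (\<zeta> X) (\<zeta> X))
        (Tob C X) (\<ell> X) (\<pi> X)"

definition fiber_neg :: "('o, 'm, 'z) tangent_data_scheme \<Rightarrow> 'o \<Rightarrow> 'm" where
  "fiber_neg C X = (THE n. is_fiber_neg C X n)"

definition fiber_diff :: "('o, 'm, 'z) tangent_data_scheme \<Rightarrow> 'o \<Rightarrow> 'm" where
  "fiber_diff C X = \<alpha> X \<cdot> tpair C X (Tpr C 2 X 0) (fiber_neg C X \<cdot> Tpr C 2 X 1)"
  for C (structure)

definition vert_lift2 :: "('o, 'm, 'z) tangent_data_scheme \<Rightarrow> 'o \<Rightarrow> 'm" where
  "vert_lift2 C X = \<tau> X \<cdot> \<alpha> (Tob C X) \<cdot>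
     tpair C (Tob C X) (Tar C (\<zeta> X) \<cdot> Tpr C 2 X 0) (\<ell> X \<cdot> Tpr C 2 X 1)"
  for C (structure)


section \<open>Vector fields\<close>

definition vector_fields :: "('o, 'm, 'z) tangent_data_scheme \<Rightarrow> 'o \<Rightarrow> 'm set" where
  "vector_fields C X = {v \<in> Hom C X (Tob C X). \<pi> X \<cdot> v = Idn C X}"
  for C (structure)

definition vf_add :: "('o, 'm, 'z) tangent_data_scheme \<Rightarrow> 'o \<Rightarrow> 'm \<Rightarrow> 'm \<Rightarrow> 'm" where
  "vf_add C X v w = \<alpha> X \<cdot> tpair C X v w"
  for C (structure)

definition vf_delta :: "('o, 'm, 'z) tangent_data_scheme \<Rightarrow> 'o \<Rightarrow> 'm \<Rightarrow> 'm \<Rightarrow> 'm" where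
  "vf_delta C X v w =
     fiber_diff C (Tob C X) \<cdot> tpair C (Tob C X) (Tar C w \<cdot> v) (\<tau> X \<cdot> Tar C v \<cdot> w)"
  for C (structure)

text \<open>Existence and uniqueness of the bracket follow from the pullback property of
  \<open>vert_lift2 C X\<close>, which is a consequence of the axioms and is not assumed.\<close>

definition vf_bracket :: "('o, 'm, 'z) tangent_data_scheme \<Rightarrow> 'o \<Rightarrow> 'm \<Rightarrow> 'm \<Rightarrow> 'm" where
  "vf_bracket C X v w =
     (THE u. u \<in> vector_fields C X \<and> vf_delta C X v w = vert_lift2 C X \<cdot> tpair C X w u)"
  for C (structure)


section \<open>Cartesian tangent structures\<close>

record ('o, 'm) cartesian_tangent_data = "('o, 'm) tangent_data" +
  One :: "'o"
  Prod :: "'o \<Rightarrow> 'o \<Rightarrow> 'o" (infixr "\<otimes>\<index>" 75)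
  pr1 :: "'o \<Rightarrow> 'o \<Rightarrow> 'm"
  pr2 :: "'o \<Rightarrow> 'o \<Rightarrow> 'm"

definition pair :: "('o, 'm, 'z) cartesian_tangent_data_scheme \<Rightarrow> 'm \<Rightarrow> 'm \<Rightarrow> 'm"
  ("\<langle>_, _\<rangle>\<index>") where
  "\<langle>f, g\<rangle> = (THE u. u \<in> Hom C (Dom C f) (Cod C f \<otimes> Cod C g) \<and>
     pr1 C (Cod C f) (Cod C g) \<cdot> u = f \<and> pr2 C (Cod C f) (Cod C g) \<cdot> u = g)"
  for C (structure)

definition prod_map :: "('o, 'm, 'z) cartesian_tangent_data_scheme \<Rightarrow> 'm \<Rightarrow> 'm \<Rightarrow> 'm" where
  "prod_map C f g = \<langle>f \<cdot> pr1 C (Dom C f) (Dom C g), g \<cdot> pr2 C (Dom C f) (Dom C g)\<rangle>"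
  for C (structure)

definition to_One :: "('o, 'm, 'z) cartesian_tangent_data_scheme \<Rightarrow> 'o \<Rightarrow> 'm" where
  "to_One C X = (THE u. u \<in> Hom C X (One C))"

definition chi :: "('o, 'm, 'z) cartesian_tangent_data_scheme \<Rightarrow> 'o \<Rightarrow> 'o \<Rightarrow> 'm" where
  "chi C X Y = \<langle>Tar C (pr1 C X Y), Tar C (pr2 C X Y)\<rangle>"
  for C (structure)

locale cartesian_tangent_category = tangent_category C
  for C :: "('o, 'm, 'z) cartesian_tangent_data_scheme" (structure) +
  assumes One: "One C \<in> Ob C"
    and One_terminal: "X \<in> Ob C \<Longrightarrow> \<exists>!u. u \<in> Hom C X (One C)"
    and Prod: "\<lbrakk>X \<in> Ob C; Y \<in> Ob C\<rbrakk> \<Longrightarrow> X \<otimes> Y \<in> Ob C"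
    and pr1: "\<lbrakk>X \<in> Ob C; Y \<in> Ob C\<rbrakk> \<Longrightarrow> pr1 C X Y \<in> Hom C (X \<otimes> Y) X"
    and pr2: "\<lbrakk>X \<in> Ob C; Y \<in> Ob C\<rbrakk> \<Longrightarrow> pr2 C X Y \<in> Hom C (X \<otimes> Y) Y"
    and Prod_universal: "\<lbrakk>f \<in> Hom C Z X; g \<in> Hom C Z Y\<rbrakk> \<Longrightarrow>
      \<exists>!u. u \<in> Hom C Z (X \<otimes> Y) \<and> pr1 C X Y \<cdot> u = f \<and> pr2 C X Y \<cdot> u = g"
    and chi_iso: "\<lbrakk>X \<in> Ob C; Y \<in> Ob C\<rbrakk> \<Longrightarrow> is_iso C (chi C X Y)"

definition partial_T1 :: "('o, 'm, 'z) cartesian_tangent_data_scheme \<Rightarrow> 'o \<Rightarrow> 'o \<Rightarrow> 'm \<Rightarrow> 'm" where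
  "partial_T1 C X Y f = Tar C f \<cdot> inv_of C (chi C X Y) \<cdot> prod_map C (Idn C (Tob C X)) (\<zeta> Y)"
  for C (structure)

definition partial_T2 :: "('o, 'm, 'z) cartesian_tangent_data_scheme \<Rightarrow> 'o \<Rightarrow> 'o \<Rightarrow> 'm \<Rightarrow> 'm" where
  "partial_T2 C X Y f = Tar C f \<cdot> inv_of C (chi C X Y) \<cdot> prod_map C (\<zeta> X) (Idn C (Tob C Y))"
  for C (structure)


section \<open>Scalar multiplication\<close>

text \<open>
  The ring object is \<open>Rg\<close>, and \<open>\<kappa>\<close> is the module structure on the tangent bundle. The tangent
  fiber of \<open>Rg\<close> at zero is \<open>T0R\<close> with inclusion \<open>T0R_incl : T0R \<rightarrow> T Rg\<close>, and
  \<open>T0R_iso : T0R \<rightarrow> Rg\<close> is the fixed module isomorphism.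
\<close>

record ('o, 'm) scalar_tangent_data = "('o, 'm) cartesian_tangent_data" +
  Rg :: "'o"
  ring_add :: "'m"
  ring_zero :: "'m"
  ring_mul :: "'m"
  ring_one :: "'m"
  scalar :: "'o \<Rightarrow> 'm" ("\<kappa>\<index>")
  T0R :: "'o"
  T0R_incl :: "'m"
  T0R_iso :: "'m"

text \<open>The projections of a triple product, which is always taken in the form \<open>(X \<times> Y) \<times> Z\<close>.\<close>

definition pr1_3 :: "('o, 'm, 'z) cartesian_tangent_data_scheme \<Rightarrow> 'o \<Rightarrow> 'o \<Rightarrow> 'o \<Rightarrow> 'm" where
  "pr1_3 C X Y Z = pr1 C X Y \<cdot> pr1 C (X \<otimes> Y) Z"
  for C (structure)

definition pr2_3 :: "('o, 'm, 'z) cartesian_tangent_data_scheme \<Rightarrow> 'o \<Rightarrow> 'o \<Rightarrow> 'o \<Rightarrow> 'm" where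
  "pr2_3 C X Y Z = pr2 C X Y \<cdot> pr1 C (X \<otimes> Y) Z"
  for C (structure)

definition pr3_3 :: "('o, 'm, 'z) cartesian_tangent_data_scheme \<Rightarrow> 'o \<Rightarrow> 'o \<Rightarrow> 'o \<Rightarrow> 'm" where
  "pr3_3 C X Y Z = pr2 C (X \<otimes> Y) Z"
  for C (structure)

definition prod_assoc :: "('o, 'm, 'z) cartesian_tangent_data_scheme \<Rightarrow> 'o \<Rightarrow> 'o \<Rightarrow> 'o \<Rightarrow> 'm" where
  "prod_assoc C X Y Z = \<langle>pr1_3 C X Y Z, \<langle>pr2_3 C X Y Z, pr3_3 C X Y Z\<rangle>\<rangle>"
  for C (structure)

definition is_ring_neg :: "('o, 'm, 'z) scalar_tangent_data_scheme \<Rightarrow> 'm \<Rightarrow> bool" where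
  "is_ring_neg C n \<longleftrightarrow> n \<in> Hom C (Rg C) (Rg C) \<and>
     ring_add C \<cdot> \<langle>n, Idn C (Rg C)\<rangle> = ring_zero C \<cdot> to_One C (Rg C)"
  for C (structure)

definition ring_neg :: "('o, 'm, 'z) scalar_tangent_data_scheme \<Rightarrow> 'm" where
  "ring_neg C = (THE n. is_ring_neg C n)"

definition comm_ring_object :: "('o, 'm, 'z) scalar_tangent_data_scheme \<Rightarrow> bool" where
  "comm_ring_object C \<longleftrightarrow> (let R = Rg C; a = ring_add C; m = ring_mul C;
       x = pr1_3 C R R R; y = pr2_3 C R R R; z = pr3_3 C R R R in
     R \<in> Ob C \<and>
     a \<in> Hom C (R \<otimes> R) R \<and> ring_zero C \<in> Hom C (One C) R \<and>
     m \<in> Hom C (R \<otimes> R) R \<and> ring_one C \<in> Hom C (One C) R \<and>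
     a \<cdot> \<langle>a \<cdot> \<langle>x, y\<rangle>, z\<rangle> = a \<cdot> \<langle>x, a \<cdot> \<langle>y, z\<rangle>\<rangle> \<and>
     a \<cdot> \<langle>pr2 C R R, pr1 C R R\<rangle> = a \<and>
     a \<cdot> \<langle>ring_zero C \<cdot> to_One C R, Idn C R\<rangle> = Idn C R \<and>
     (\<exists>n. is_ring_neg C n) \<and>
     m \<cdot> \<langle>m \<cdot> \<langle>x, y\<rangle>, z\<rangle> = m \<cdot> \<langle>x, m \<cdot> \<langle>y, z\<rangle>\<rangle> \<and>
     m \<cdot> \<langle>pr2 C R R, pr1 C R R\<rangle> = m \<and>
     m \<cdot> \<langle>ring_one C \<cdot> to_One C R, Idn C R\<rangle> = Idn C R \<and>
     m \<cdot> \<langle>x, a \<cdot> \<langle>y, z\<rangle>\<rangle> = a \<cdot> \<langle>m \<cdot> \<langle>x, y\<rangle>, m \<cdot> \<langle>x, z\<rangle>\<rangle>)"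
  for C (structure)

text \<open>The unit axiom uses that the canonical isomorphism \<open>One \<times> T X \<rightarrow> T X\<close> is the second
  projection.\<close>

definition tangent_module :: "('o, 'm, 'z) scalar_tangent_data_scheme \<Rightarrow> bool" where
  "tangent_module C \<longleftrightarrow> (let R = Rg C in
     (\<forall>X\<in>Ob C. \<kappa> X \<in> Hom C (R \<otimes> Tob C X) (Tob C X)) \<and>
     (\<forall>X Y. \<forall>f\<in>Hom C X Y. \<kappa> Y \<cdot> prod_map C (Idn C R) (Tar C f) = Tar C f \<cdot> \<kappa> X) \<and>
     (\<forall>X\<in>Ob C. let TX = Tob C X;
        r = pr1_3 C R R TX; s = pr2_3 C R R TX; t = pr3_3 C R R TX in
      \<pi> X \<cdot> \<kappa> X = \<pi> X \<cdot> pr2 C R TX \<and>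
      \<kappa> X \<cdot> prod_map C (Idn C R) (\<kappa> X) \<cdot> prod_assoc C R R TX
        = \<kappa> X \<cdot> prod_map C (ring_mul C) (Idn C TX) \<and>
      \<kappa> X \<cdot> prod_map C (ring_one C) (Idn C TX) = pr2 C (One C) TX \<and>
      \<kappa> X \<cdot> prod_map C (ring_add C) (Idn C TX)
        = \<alpha> X \<cdot> tpair C X (\<kappa> X \<cdot> \<langle>r, t\<rangle>) (\<kappa> X \<cdot> \<langle>s, t\<rangle>) \<and>
      \<kappa> X \<cdot> prod_map C (Idn C R) (\<alpha> X)
        = \<alpha> X \<cdot> tpair C X
            (\<kappa> X \<cdot> \<langle>pr1 C R (Tpow C 2 X), Tpr C 2 X 0 \<cdot> pr2 C R (Tpow C 2 X)\<rangle>)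
            (\<kappa> X \<cdot> \<langle>pr1 C R (Tpow C 2 X), Tpr C 2 X 1 \<cdot> pr2 C R (Tpow C 2 X)\<rangle>)))"
  for C (structure)

text \<open>The module structure on the tangent fiber inherited from that of \<open>T Rg\<close>.\<close>

definition T0R_add :: "('o, 'm, 'z) scalar_tangent_data_scheme \<Rightarrow> 'm" where
  "T0R_add C = (THE u. u \<in> Hom C (T0R C \<otimes> T0R C) (T0R C) \<and>
     T0R_incl C \<cdot> u = \<alpha> (Rg C) \<cdot> tpair C (Rg C)
       (T0R_incl C \<cdot> pr1 C (T0R C) (T0R C)) (T0R_incl C \<cdot> pr2 C (T0R C) (T0R C)))"
  for C (structure)

definition T0R_scalar :: "('o, 'm, 'z) scalar_tangent_data_scheme \<Rightarrow> 'm" where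
  "T0R_scalar C = (THE u. u \<in> Hom C (Rg C \<otimes> T0R C) (T0R C) \<and>
     T0R_incl C \<cdot> u = \<kappa> (Rg C) \<cdot> prod_map C (Idn C (Rg C)) (T0R_incl C))"
  for C (structure)

definition tangent_stable :: "('o, 'm, 'z) scalar_tangent_data_scheme \<Rightarrow> bool" where
  "tangent_stable C \<longleftrightarrow>
     is_pullback C (ring_zero C) (\<pi> (Rg C)) (T0R C) (to_One C (T0R C)) (T0R_incl C) \<and>
     T0R_iso C \<in> Hom C (T0R C) (Rg C) \<and> is_iso C (T0R_iso C) \<and>
     T0R_iso C \<cdot> T0R_add C = ring_add C \<cdot> prod_map C (T0R_iso C) (T0R_iso C) \<and>
     T0R_iso C \<cdot> T0R_scalar C = ring_mul C \<cdot> prod_map C (Idn C (Rg C)) (T0R_iso C)"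
  for C (structure)

definition eta :: "('o, 'm, 'z) scalar_tangent_data_scheme \<Rightarrow> 'm" where
  "eta C = T0R_iso C \<cdot> (THE u. u \<in> Hom C (Tob C (Rg C)) (T0R C) \<and>
     T0R_incl C \<cdot> u = partial_T2 C (Rg C) (Rg C) (ring_add C) \<cdot>
       \<langle>ring_neg C \<cdot> \<pi> (Rg C), Idn C (Tob C (Rg C))\<rangle>)"
  for C (structure)

locale scalar_tangent_category = cartesian_tangent_category C
  for C :: "('o, 'm, 'z) scalar_tangent_data_scheme" (structure) +
  assumes ring_object: "comm_ring_object C"
    and module: "tangent_module C"
    and stable: "tangent_stable C"
    and S1: "X \<in> Ob C \<Longrightarrow>
      \<ell> X \<cdot> \<kappa> X = \<kappa> (Tob C X) \<cdot> prod_map C (Idn C (Rg C)) (\<ell> X)"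
    and S2: "X \<in> Ob C \<Longrightarrow>
      partial_T1 C (Rg C) (Tob C X) (\<kappa> X)
        = vert_lift2 C X \<cdot>
          tpair C X
            (\<kappa> X \<cdot> \<langle>pr1_3 C (Rg C) (Rg C) (Tob C X), pr3_3 C (Rg C) (Rg C) (Tob C X)\<rangle>)
            (\<kappa> X \<cdot> \<langle>pr2_3 C (Rg C) (Rg C) (Tob C X), pr3_3 C (Rg C) (Rg C) (Tob C X)\<rangle>) \<cdot>
          prod_map C \<langle>\<pi> (Rg C), eta C\<rangle> (Idn C (Tob C X))"
    and S3: "X \<in> Ob C \<Longrightarrow>
      partial_T2 C (Rg C) (Tob C X) (\<kappa> X)
        = \<tau> X \<cdot> \<kappa> (Tob C X) \<cdot> prod_map C (Idn C (Rg C)) (\<tau> X)"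

definition fun_scale :: "('o, 'm, 'z) scalar_tangent_data_scheme \<Rightarrow> 'o \<Rightarrow> 'm \<Rightarrow> 'm \<Rightarrow> 'm" where
  "fun_scale C X f v = \<kappa> X \<cdot> \<langle>f, v\<rangle>"
  for C (structure)

definition vf_action :: "('o, 'm, 'z) scalar_tangent_data_scheme \<Rightarrow> 'm \<Rightarrow> 'm \<Rightarrow> 'm" where
  "vf_action C v f = eta C \<cdot> Tar C f \<cdot> v"
  for C (structure)

end

theory Submission
  imports Defs
begin

text \<open>
  Write \<open>\<lambda>\<^sub>2(a, b) = \<tau> \<circ> (T\<zeta> \<circ> a + \<ell> \<circ> b)\<close>. The bracket is determined by
  \<open>\<lambda>\<^sub>2(w, [v, w]) + \<tau> \<circ> Tv \<circ> w = Tw \<circ> v\<close>. Splitting \<open>T(f w) \<circ> v = T\<kappa> \<circ> (Tf \<circ> v, Tw \<circ> v)\<close> into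
  partial tangent morphisms gives, by (S2), the term \<open>\<lambda>\<^sub>2(f w, (v \<cdot> f) w)\<close> plus the image of
  \<open>Tw \<circ> v\<close> under the additive map \<open>F = T\<^sub>2\<kappa> \<circ> (f, _)\<close>. By (S3), \<open>F\<close> sends
  \<open>\<tau> \<circ> Tv \<circ> w\<close> to \<open>\<tau> \<circ> Tv \<circ> (f w)\<close>, and with (S1) it sends \<open>\<lambda>\<^sub>2(w, u)\<close> to
  \<open>\<lambda>\<^sub>2(f w, f u)\<close>. Since \<open>\<lambda>\<^sub>2\<close> is additive in its second argument, \<open>\<delta>(v, f w)\<close> equals
  \<open>\<lambda>\<^sub>2(f w, (v \<cdot> f) w + f [v, w])\<close>.
\<close>

section \<open>Arrows\<close>

text \<open>A sum in a tangent bundle exists only for arrows with the same base point, and pairings,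
  negatives, brackets and \<open>eta\<close> are definite descriptions that mean nothing before
  existence and uniqueness are shown. Laws are therefore restated for arrows of arbitrary domain,
  read as points, with \<open>same_fiber\<close> as side condition, and differences are traded for
  sums: the subtrahend is added back and then cancelled.

  The delicate point is that T (T X) carries two additions, over \<open>\<pi> (Tob C X)\<close> and
  over \<open>Tar C (\<pi> X)\<close>, related only through the flip.
  \<open>\<lambda>\<^sub>2\<close> has a sum inside the flip, and its additivity concerns a sum
  outside the flip. So it is an interchange law: a two-by-two array of points is encoded in T (T_2
  X) and added up by rows and by columns.

  The bracket exists and is unique because of the pullback square of \<ell>: flipping
  \<open>\<lambda>\<^sub>2(w, u)\<close> and subtracting the summand that contains w leaves the
  vertical lift of u. The splitting into partial tangent morphisms rests on the decomposition (a, b)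
  = (a, 0) + (0, b) of a tangent vector of a product.\<close>

context category
begin

lemma idn_simps [simp]:
  assumes "X \<in> Ob C"
  shows "Idn C X \<in> Ar C" "Dom C (Idn C X) = X" "Cod C (Idn C X) = X"
  using idn[OF assms] by (auto simp: Hom_def)

lemma dom_cod_in_Ob [simp]:
  assumes "f \<in> Ar C"
  shows "Dom C f \<in> Ob C" "Cod C f \<in> Ob C"
  using dom_cod[OF assms] by auto

lemma comp_simps [simp]:
  assumes "f \<in> Ar C" "g \<in> Ar C" "Cod C f = Dom C g"
  shows "g \<cdot> f \<in> Ar C" "Dom C (g \<cdot> f) = Dom C f" "Cod C (g \<cdot> f) = Cod C g"
  using comp[of f "Dom C f" "Cod C f" g "Cod C g"] assms by (auto simp: Hom_def)

lemma comp_assoc_arr [simp]: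
  assumes "f \<in> Ar C" "g \<in> Ar C" "h \<in> Ar C" "Cod C f = Dom C g" "Cod C g = Dom C h"
  shows "(h \<cdot> g) \<cdot> f = h \<cdot> (g \<cdot> f)"
  using comp_assoc[of f "Dom C f" "Cod C f" g "Cod C g" h "Cod C h"] assms
  by (auto simp: Hom_def)

lemma comp_idn_arr [simp]: "f \<in> Ar C \<Longrightarrow> Dom C f = X \<Longrightarrow> f \<cdot> Idn C X = f"
  using comp_idn[of f "Dom C f" "Cod C f"] by (auto simp: Hom_def)

lemma idn_comp_arr [simp]: "f \<in> Ar C \<Longrightarrow> Cod C f = X \<Longrightarrow> Idn C X \<cdot> f = f"
  using idn_comp[of f "Dom C f" "Cod C f"] by (auto simp: Hom_def)

text \<open>Composites are normalised to right-nested form, in which \<open>g \<cdot> f\<close> is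
  no longer a subterm once another arrow is precomposed. This reassociated version carries equations
  between structure arrows over to points.\<close>

lemma comp_eq_comp:
  assumes "g \<cdot> f = k" "f \<in> Ar C" "g \<in> Ar C" "h \<in> Ar C" "Cod C f = Dom C g" "Cod C h = Dom C f"
  shows "g \<cdot> (f \<cdot> h) = k \<cdot> h"
  using comp_assoc_arr[of h f g] assms by simp

lemma is_inverse_unique:
  assumes "is_inverse C f g" "is_inverse C f h"
  shows "g = h"
proof -
  have "g = g \<cdot> (f \<cdot> h)" using assms by (auto simp: is_inverse_def Hom_def)
  also have "\<dots> = (g \<cdot> f) \<cdot> h" using assms by (subst comp_assoc_arr) (auto simp: is_inverse_def Hom_def)
  also have "\<dots> = h" using assms by (auto simp: is_inverse_def Hom_def)
  finally show ?thesis .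
qed

lemma is_inverse_inv_of: "is_iso C f \<Longrightarrow> is_inverse C f (inv_of C f)"
  unfolding is_iso_def inv_of_def
  by (metis is_inverse_unique theI)

section \<open>Universal properties of pullbacks and fiber powers\<close>

lemma pullback_eqI:
  assumes "is_pullback C f g P p q" "u \<in> Ar C" "u' \<in> Ar C" "Cod C u = P" "Cod C u' = P"
    "Dom C u = Dom C u'" "p \<cdot> u = p \<cdot> u'" "q \<cdot> u = q \<cdot> u'"
  shows "u = u'"
proof -
  let ?Z = "Dom C u'"
  have a: "f \<in> Ar C" "g \<in> Ar C" "Cod C f = Cod C g" "p \<in> Hom C P (Dom C f)" "q \<in> Hom C P (Dom C g)" "f \<cdot> p = g \<cdot> q"
    and U: "\<forall>Z\<in>Ob C. \<forall>a\<in>Hom C Z (Dom C f). \<forall>b\<in>Hom C Z (Dom C g). f \<cdot> a = g \<cdot> b \<longrightarrow>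
        (\<exists>!u. u \<in> Hom C Z P \<and> p \<cdot> u = a \<and> q \<cdot> u = b)"
    using assms(1) unfolding is_pullback_def by blast+
  have "f \<cdot> (p \<cdot> u') = (g \<cdot> q) \<cdot> u'"
    by (rule comp_eq_comp) (use a assms(2-6) in \<open>auto simp: Hom_def\<close>)
  hence e: "f \<cdot> (p \<cdot> u') = g \<cdot> (q \<cdot> u')" using a assms(3,5) by (simp add: Hom_def)
  have "?Z \<in> Ob C" "p \<cdot> u' \<in> Hom C ?Z (Dom C f)" "q \<cdot> u' \<in> Hom C ?Z (Dom C g)"
    using a assms(3,5) by (auto simp: Hom_def)
  hence "\<exists>!u. u \<in> Hom C ?Z P \<and> p \<cdot> u = p \<cdot> u' \<and> q \<cdot> u = q \<cdot> u'" using U e by blast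
  moreover have "u \<in> Hom C ?Z P" "u' \<in> Hom C ?Z P" using assms(2-6) by (auto simp: Hom_def)
  ultimately show ?thesis using assms(7,8) by blast
qed

lemma pullback_lift:
  assumes "is_pullback C f g P p q" "a \<in> Hom C Z (Dom C f)" "b \<in> Hom C Z (Dom C g)" "f \<cdot> a = g \<cdot> b"
  shows "\<exists>!u. u \<in> Hom C Z P \<and> p \<cdot> u = a \<and> q \<cdot> u = b"
proof -
  have U: "\<forall>Z\<in>Ob C. \<forall>a\<in>Hom C Z (Dom C f). \<forall>b\<in>Hom C Z (Dom C g). f \<cdot> a = g \<cdot> b \<longrightarrow>
        (\<exists>!u. u \<in> Hom C Z P \<and> p \<cdot> u = a \<and> q \<cdot> u = b)"
    using assms(1) unfolding is_pullback_def by blast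
  have "Z \<in> Ob C" using assms(2) by (auto simp: Hom_def)
  thus ?thesis using U assms(2-4) by blast
qed

lemma fiber_power_proj:
  assumes "is_fiber_power C p k P q" "i < k"
  shows "q i \<in> Hom C P (Dom C p)"
  using assms unfolding is_fiber_power_def by blast

lemma fiber_power_proj_eq:
  assumes "is_fiber_power C p k P q" "i < k" "j < k"
  shows "p \<cdot> q i = p \<cdot> q j"
  using assms unfolding is_fiber_power_def by blast

lemma fiber_power_lift:
  assumes "is_fiber_power C p k P q" "Z \<in> Ob C"
    "\<forall>i<k. h i \<in> Hom C Z (Dom C p)" "\<forall>i<k. \<forall>j<k. p \<cdot> h i = p \<cdot> h j"
  shows "\<exists>!u. u \<in> Hom C Z P \<and> (\<forall>i<k. q i \<cdot> u = h i)"
proof -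
  have "\<forall>Z\<in>Ob C. \<forall>h. (\<forall>i<k. h i \<in> Hom C Z (Dom C p)) \<and> (\<forall>i<k. \<forall>j<k. p \<cdot> h i = p \<cdot> h j) \<longrightarrow>
        (\<exists>!u. u \<in> Hom C Z P \<and> (\<forall>i<k. q i \<cdot> u = h i))"
    using assms(1) unfolding is_fiber_power_def by blast
  from this[rule_format (no_asm), OF assms(2), of h] show ?thesis using assms(3,4) by blast
qed

end

section \<open>Fiberwise addition\<close>

context tangent_category
begin

lemma structure_simps [simp]:
  assumes "X \<in> Ob C"
  shows "Tob C X \<in> Ob C"
    "\<pi> X \<in> Ar C" "Dom C (\<pi> X) = Tob C X" "Cod C (\<pi> X) = X"
    "\<zeta> X \<in> Ar C" "Dom C (\<zeta> X) = X" "Cod C (\<zeta> X) = Tob C X"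
    "\<alpha> X \<in> Ar C" "Dom C (\<alpha> X) = Tpow C 2 X" "Cod C (\<alpha> X) = Tob C X"
    "\<ell> X \<in> Ar C" "Dom C (\<ell> X) = Tob C X" "Cod C (\<ell> X) = Tob C (Tob C X)"
    "\<tau> X \<in> Ar C" "Dom C (\<tau> X) = Tob C (Tob C X)" "Cod C (\<tau> X) = Tob C (Tob C X)"
  using assms[THEN Tob] assms[THEN bundle_proj] assms[THEN zero_section] assms[THEN fiber_add]
    assms[THEN vert_lift] assms[THEN sym_flip] by (auto simp: Hom_def)

lemma Tar_simps [simp]:
  assumes "f \<in> Ar C"
  shows "Tar C f \<in> Ar C" "Dom C (Tar C f) = Tob C (Dom C f)" "Cod C (Tar C f) = Tob C (Cod C f)"
  using Tar[of f "Dom C f" "Cod C f"] assms by (auto simp: Hom_def)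

lemma Tar_comp_arr:
  assumes "f \<in> Ar C" "g \<in> Ar C" "Cod C f = Dom C g"
  shows "Tar C (g \<cdot> f) = Tar C g \<cdot> Tar C f"
  using Tar_comp[of f "Dom C f" "Cod C f" g "Cod C g"] assms by (auto simp: Hom_def)

lemma proj_Tar:
  assumes "f \<in> Ar C" "x \<in> Ar C" "Cod C x = Tob C (Dom C f)"
    "Cod C f = Y"
  shows "\<pi> Y \<cdot> (Tar C f \<cdot> x) = f \<cdot> (\<pi> (Dom C f) \<cdot> x)"
  using comp_eq_comp[OF bundle_proj_natural[of f "Dom C f" Y], of x] assms
  by (auto simp: Hom_def)

lemma proj_zero:
  assumes "X \<in> Ob C" "x \<in> Ar C" "Cod C x = X"
  shows "\<pi> X \<cdot> (\<zeta> X \<cdot> x) = x"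
proof -
  have "\<pi> X \<cdot> \<zeta> X = Idn C X" using group_bundle[OF assms(1)] unfolding abelian_group_bundle_def by blast
  from comp_eq_comp[OF this, of x] assms show ?thesis by simp
qed

lemma Tpow_simps [simp]:
  assumes "X \<in> Ob C" "i < k"
  shows "Tpow C k X \<in> Ob C" "Tpr C k X i \<in> Ar C" "Dom C (Tpr C k X i) = Tpow C k X"
    "Cod C (Tpr C k X i) = Tob C X"
proof -
  have "is_fiber_power C (\<pi> X) k (Tpow C k X) (Tpr C k X)" using Tpow assms by simp
  from fiber_power_proj[OF this assms(2)] show *: "Tpr C k X i \<in> Ar C"
    "Dom C (Tpr C k X i) = Tpow C k X" "Cod C (Tpr C k X i) = Tob C X"
    using assms(1) by (auto simp: Hom_def)
  show "Tpow C k X \<in> Ob C" using dom_cod_in_Ob(1)[OF *(1)] *(2) by simp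
qed

lemma proj_Tpr:
  assumes "X \<in> Ob C" "i < k" "j < k"
  shows "\<pi> X \<cdot> Tpr C k X i = \<pi> X \<cdot> Tpr C k X j"
  by (rule fiber_power_proj_eq[OF Tpow]) (use assms in auto)

text \<open>The domain of the partial operation \<open>vf_add C X\<close>, here used for arbitrary
  points of the tangent bundle and not only for sections. Outside it the pairing
  \<open>tpair\<close> is unspecified. \<open>X\<close> is an argument because
  \<open>Tob C X\<close> does not determine it.\<close>

definition same_fiber :: "'o \<Rightarrow> 'm \<Rightarrow> 'm \<Rightarrow> bool" where
  "same_fiber X f g \<longleftrightarrow> X \<in> Ob C \<and> f \<in> Ar C \<and> g \<in> Ar C \<and> Dom C f = Dom C g \<and>
     Cod C f = Tob C X \<and> Cod C g = Tob C X \<and> \<pi> X \<cdot> f = \<pi> X \<cdot> g"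

lemma same_fiberD:
  assumes "same_fiber X f g"
  shows "X \<in> Ob C" "f \<in> Ar C" "g \<in> Ar C" "Dom C f = Dom C g"
    "Cod C f = Tob C X" "Cod C g = Tob C X" "\<pi> X \<cdot> f = \<pi> X \<cdot> g"
  using assms by (auto simp: same_fiber_def)

lemma same_fiber_sym: "same_fiber X f g \<Longrightarrow> same_fiber X g f"
  by (auto simp: same_fiber_def)

lemma same_fiber_trans: "same_fiber X f g \<Longrightarrow> same_fiber X g h \<Longrightarrow> same_fiber X f h"
  by (auto simp: same_fiber_def)

lemma same_fiber_comp:
  assumes "same_fiber X f g" "h \<in> Ar C" "Cod C h = Dom C f"
  shows "same_fiber X (f \<cdot> h) (g \<cdot> h)"
proof -
  note [simp] = same_fiberD[OF assms(1)]
  \<comment> \<open>As a rewrite rule the fiber equation would turn the right side into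
    \<open>\<pi> X \<cdot> (g \<cdot> h)\<close>, which is the claim itself. Without it only
    reassociation is left.\<close>
  have "\<pi> X \<cdot> (f \<cdot> h) = (\<pi> X \<cdot> f) \<cdot> h" using assms same_fiberD(1-6)[OF assms(1)]
    by (simp del: same_fiberD(7)[OF assms(1)])
  also have "\<dots> = \<pi> X \<cdot> (g \<cdot> h)" using assms by simp
  finally show ?thesis using assms by (simp add: same_fiber_def)
qed

section \<open>Points of T_2 X and the laws of fiberwise sums\<close>

lemma tpair_ex1:
  assumes "same_fiber X f g"
  shows "\<exists>!u. u \<in> Hom C (Dom C f) (Tpow C 2 X) \<and> Tpr C 2 X 0 \<cdot> u = f \<and> Tpr C 2 X 1 \<cdot> u = g"
proof -
  note D = same_fiberD[OF assms]
  have "is_fiber_power C (\<pi> X) 2 (Tpow C 2 X) (Tpr C 2 X)" using Tpow D(1) by simp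
  moreover have "\<forall>i<2. (if i = 0 then f else g) \<in> Hom C (Dom C f) (Dom C (\<pi> X))"
    "\<forall>i<2::nat. \<forall>j<2::nat. \<pi> X \<cdot> (if i = 0 then f else g) = \<pi> X \<cdot> (if j = 0 then f else g)"
    using D by (simp_all add: Hom_def)
  ultimately have "\<exists>!u. u \<in> Hom C (Dom C f) (Tpow C 2 X) \<and> (\<forall>i<2. Tpr C 2 X i \<cdot> u = (if i = 0 then f else g))"
    by (rule fiber_power_lift[OF _ dom_cod_in_Ob(1)[OF D(2)]])
  moreover have "(\<forall>i<2. P i) \<longleftrightarrow> P 0 \<and> P 1" for P :: "nat \<Rightarrow> bool"
    by (auto simp: less_2_cases_iff)
  ultimately show ?thesis by simp
qed

lemma tpair_props:
  assumes "same_fiber X f g"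
  shows "tpair C X f g \<in> Ar C" "Dom C (tpair C X f g) = Dom C f" "Cod C (tpair C X f g) = Tpow C 2 X"
    "Tpr C 2 X 0 \<cdot> tpair C X f g = f" "Tpr C 2 X 1 \<cdot> tpair C X f g = g"
  using theI'[OF tpair_ex1[OF assms], folded tpair_def] by (auto simp: Hom_def)

lemma tpair_unique:
  assumes "same_fiber X f g" "u \<in> Ar C" "Cod C u = Tpow C 2 X" "Dom C u = Dom C f"
    "Tpr C 2 X 0 \<cdot> u = f" "Tpr C 2 X 1 \<cdot> u = g"
  shows "u = tpair C X f g"
  using tpair_ex1[OF assms(1)] tpair_props[OF assms(1)] assms(2-6) by (auto simp: Hom_def)

lemma tpair_comp:
  assumes "same_fiber X f g" "h \<in> Ar C" "Cod C h = Dom C f"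
  shows "tpair C X f g \<cdot> h = tpair C X (f \<cdot> h) (g \<cdot> h)"
proof (rule tpair_unique)
  note P = tpair_props[OF assms(1)] same_fiberD[OF assms(1)]
  show "same_fiber X (f \<cdot> h) (g \<cdot> h)" using same_fiber_comp assms .
  show "Tpr C 2 X 0 \<cdot> (tpair C X f g \<cdot> h) = f \<cdot> h"
    by (rule comp_eq_comp) (use P assms in auto)
  show "Tpr C 2 X 1 \<cdot> (tpair C X f g \<cdot> h) = g \<cdot> h"
    by (rule comp_eq_comp) (use P assms in auto)
qed (use assms same_fiberD[OF assms(1)] tpair_props[OF assms(1)] in auto)

lemma vf_add_typing [simp]:
  assumes "same_fiber X f g"
  shows "vf_add C X f g \<in> Ar C" "Dom C (vf_add C X f g) = Dom C f" "Cod C (vf_add C X f g) = Tob C X"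
  using tpair_props[OF assms] same_fiberD[OF assms] by (auto simp: vf_add_def)

lemma vf_add_comp:
  assumes "same_fiber X f g" "h \<in> Ar C" "Cod C h = Dom C f"
  shows "vf_add C X f g \<cdot> h = vf_add C X (f \<cdot> h) (g \<cdot> h)"
  using tpair_comp[OF assms] tpair_props[OF assms(1)] same_fiberD[OF assms(1)] assms(2,3)
  by (simp add: vf_add_def)

lemma proj_vf_add:
  assumes "same_fiber X f g"
  shows "\<pi> X \<cdot> vf_add C X f g = \<pi> X \<cdot> f"
proof -
  note P = tpair_props[OF assms] same_fiberD[OF assms]
  have 1: "\<pi> X \<cdot> \<alpha> X = \<pi> X \<cdot> Tpr C 2 X 0"
    using group_bundle[of X] P unfolding abelian_group_bundle_def by blast
  have "\<pi> X \<cdot> vf_add C X f g = (\<pi> X \<cdot> Tpr C 2 X 0) \<cdot> tpair C X f g"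
    unfolding vf_add_def by (rule comp_eq_comp[OF 1]) (use P in auto)
  thus ?thesis using P by simp
qed

lemma same_fiber_vf_add:
  assumes "same_fiber X f g" "same_fiber X f h"
  shows "same_fiber X (vf_add C X f g) h" "same_fiber X h (vf_add C X f g)"
  using assms vf_add_typing[OF assms(1)] proj_vf_add[OF assms(1)] by (auto simp: same_fiber_def)

text \<open>Three points over one base point are a single arrow \<open>u\<close> into
  \<open>Tpow C 3 X\<close>. The group axiom is an equation between arrows out of that object, and
  precomposing it with \<open>u\<close> gives the law.\<close>

lemma vf_add_assoc:
  assumes "same_fiber X f g" "same_fiber X f h"
  shows "vf_add C X (vf_add C X f g) h = vf_add C X f (vf_add C X g h)"
proof -
  note D = same_fiberD[OF assms(1)] same_fiberD[OF assms(2)]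
  let ?p = "Tpr C 3 X"
  have all3: "(\<forall>i<3. P i) \<longleftrightarrow> P 0 \<and> P 1 \<and> P 2" for P :: "nat \<Rightarrow> bool"
    by (auto simp: less_Suc_eq numeral_3_eq_3 numeral_2_eq_2)
  have "is_fiber_power C (\<pi> X) 3 (Tpow C 3 X) ?p" using Tpow D(1) by simp
  moreover have "\<forall>i<3. [f, g, h] ! i \<in> Hom C (Dom C f) (Dom C (\<pi> X))"
    "\<forall>i<3. \<forall>j<3. \<pi> X \<cdot> [f, g, h] ! i = \<pi> X \<cdot> [f, g, h] ! j"
    unfolding all3 using D by (simp_all add: Hom_def)
  ultimately have "\<exists>!u. u \<in> Hom C (Dom C f) (Tpow C 3 X) \<and> (\<forall>i<3. ?p i \<cdot> u = [f, g, h] ! i)"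
    by (rule fiber_power_lift[OF _ dom_cod_in_Ob(1)[OF D(2)]])
  then obtain u where u: "u \<in> Hom C (Dom C f) (Tpow C 3 X)" and pu': "\<forall>i<3. ?p i \<cdot> u = [f, g, h] ! i"
    by blast
  have pu: "?p 0 \<cdot> u = f" "?p 1 \<cdot> u = g" "?p 2 \<cdot> u = h"
    using pu'[rule_format, of 0] pu'[rule_format, of 1] pu'[rule_format, of 2] by auto
  have s: "same_fiber X (?p i) (?p j)" if "i < 3" "j < 3" for i j
    using that D proj_Tpr[of X i 3 j] by (auto simp: same_fiber_def)
  have ax: "vf_add C X (vf_add C X (?p 0) (?p 1)) (?p 2) = vf_add C X (?p 0) (vf_add C X (?p 1) (?p 2))"
    using group_bundle[OF D(1)] unfolding abelian_group_bundle_def vf_add_def by blast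
  have s2: "same_fiber X (vf_add C X (?p 0) (?p 1)) (?p 2)" "same_fiber X (?p 0) (vf_add C X (?p 1) (?p 2))"
    using same_fiber_vf_add s by simp_all
  have "vf_add C X (vf_add C X (?p 0) (?p 1)) (?p 2) \<cdot> u = vf_add C X (vf_add C X f g) h"
    using u s D by (simp add: vf_add_comp s2 pu Hom_def del: One_nat_def)
  moreover have "vf_add C X (?p 0) (vf_add C X (?p 1) (?p 2)) \<cdot> u = vf_add C X f (vf_add C X g h)"
    using u s D by (simp add: vf_add_comp s2 pu Hom_def del: One_nat_def)
  ultimately show ?thesis using ax by simp
qed

lemma vf_add_commute:
  assumes "same_fiber X f g"
  shows "vf_add C X f g = vf_add C X g f"
proof -
  note P = tpair_props[OF assms] same_fiberD[OF assms]
  have s: "same_fiber X (Tpr C 2 X 1) (Tpr C 2 X 0)"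
    using proj_Tpr[of X 1 2 0] P by (auto simp: same_fiber_def)
  have ax: "vf_add C X (Tpr C 2 X 1) (Tpr C 2 X 0) = \<alpha> X"
    using group_bundle[OF P(6)] unfolding abelian_group_bundle_def vf_add_def by blast
  have "vf_add C X f g = vf_add C X (Tpr C 2 X 1) (Tpr C 2 X 0) \<cdot> tpair C X f g"
    unfolding ax by (simp add: vf_add_def)
  also have "\<dots> = vf_add C X g f" by (subst vf_add_comp[OF s]) (use P in auto)
  finally show ?thesis .
qed

lemma same_fiber_zero:
  assumes "X \<in> Ob C" "f \<in> Ar C" "Cod C f = Tob C X"
  shows "same_fiber X (\<zeta> X \<cdot> (\<pi> X \<cdot> f)) f"
  using assms by (auto simp: same_fiber_def proj_zero)

lemma vf_add_zero_left:
  assumes "X \<in> Ob C" "f \<in> Ar C" "Cod C f = Tob C X"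
  shows "vf_add C X (\<zeta> X \<cdot> (\<pi> X \<cdot> f)) f = f"
proof -
  have ax: "vf_add C X (\<zeta> X \<cdot> \<pi> X) (Idn C (Tob C X)) = Idn C (Tob C X)"
    using group_bundle[OF assms(1)] unfolding abelian_group_bundle_def vf_add_def by blast
  have s: "same_fiber X (\<zeta> X \<cdot> \<pi> X) (Idn C (Tob C X))"
    using assms by (auto simp: same_fiber_def proj_zero)
  have "vf_add C X (\<zeta> X \<cdot> \<pi> X) (Idn C (Tob C X)) \<cdot> f = vf_add C X (\<zeta> X \<cdot> (\<pi> X \<cdot> f)) f"
    by (subst vf_add_comp[OF s]) (use assms in auto)
  thus ?thesis using assms by (simp add: ax)
qed

lemma vf_add_zero_right:
  assumes "same_fiber X f g"
  shows "vf_add C X f (\<zeta> X \<cdot> (\<pi> X \<cdot> g)) = f"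
proof -
  note D = same_fiberD[OF assms]
  show ?thesis
    using vf_add_commute[OF same_fiber_zero[of X f]] vf_add_zero_left[of X f] D by simp
qed

section \<open>Fiberwise negatives, cancellation and differences\<close>

lemma is_fiber_neg_comp:
  assumes "is_fiber_neg C X n" "X \<in> Ob C" "f \<in> Ar C" "Cod C f = Tob C X"
  shows "same_fiber X (n \<cdot> f) f" "vf_add C X (n \<cdot> f) f = \<zeta> X \<cdot> (\<pi> X \<cdot> f)"
proof -
  have n: "n \<in> Ar C" "Dom C n = Tob C X" "Cod C n = Tob C X" "\<pi> X \<cdot> n = \<pi> X"
    "vf_add C X n (Idn C (Tob C X)) = \<zeta> X \<cdot> \<pi> X"
    using assms(1) by (auto simp: is_fiber_neg_def Hom_def vf_add_def)
  have s: "same_fiber X n (Idn C (Tob C X))" using n assms by (auto simp: same_fiber_def)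
  from same_fiber_comp[OF s, of f] show "same_fiber X (n \<cdot> f) f" using n assms by simp
  from vf_add_comp[OF s, of f] show "vf_add C X (n \<cdot> f) f = \<zeta> X \<cdot> (\<pi> X \<cdot> f)" using n assms by simp
qed

text \<open>Adding a negative of \<open>h\<close> recovers the other summand. Any negative will do,
  so its uniqueness is not presupposed and can be derived from this lemma.\<close>

lemma vf_add_cancel:
  assumes "same_fiber X f h" "same_fiber X g h" "vf_add C X f h = vf_add C X g h"
  shows "f = g"
proof -
  note D = same_fiberD[OF assms(1)] same_fiberD[OF assms(2)]
  obtain n where n: "is_fiber_neg C X n"
    using group_bundle[OF D(1)] unfolding abelian_group_bundle_def by blast
  note N = is_fiber_neg_comp[OF n, of h]
  have *: "vf_add C X (vf_add C X k h) (n \<cdot> h) = k" if s: "same_fiber X k h" for k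
  proof -
    note K = same_fiberD[OF s]
    have s2: "same_fiber X k (n \<cdot> h)" using same_fiber_trans[OF s same_fiber_sym] N K by auto
    have s3: "same_fiber X h (n \<cdot> h)" using same_fiber_sym N K by auto
    have "vf_add C X (vf_add C X k h) (n \<cdot> h) = vf_add C X k (vf_add C X h (n \<cdot> h))"
      using vf_add_assoc s s2 by blast
    also have "vf_add C X h (n \<cdot> h) = \<zeta> X \<cdot> (\<pi> X \<cdot> h)"
      using vf_add_commute[OF s3] N K by simp
    also have "vf_add C X k \<dots> = k" by (rule vf_add_zero_right[OF s])
    finally show ?thesis .
  qed
  show ?thesis by (rule trans[OF *[OF assms(1), symmetric, unfolded assms(3)] *[OF assms(2)]])
qed

text \<open>The axioms only assert that some negative exists. Cancelling the generic point
  \<open>Idn C (Tob C X)\<close> shows that two negatives agree, which gives the definite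
  description its meaning.\<close>

lemma is_fiber_neg_fiber_neg:
  assumes "X \<in> Ob C"
  shows "is_fiber_neg C X (fiber_neg C X)"
proof -
  obtain n where n: "is_fiber_neg C X n"
    using group_bundle[OF assms] unfolding abelian_group_bundle_def by blast
  have "m = n" if m: "is_fiber_neg C X m" for m
  proof (rule vf_add_cancel)
    have a: "m \<in> Ar C" "n \<in> Ar C" "Dom C m = Tob C X" "Dom C n = Tob C X"
      using m n by (auto simp: is_fiber_neg_def Hom_def)
    show "same_fiber X m (Idn C (Tob C X))" "same_fiber X n (Idn C (Tob C X))"
      "vf_add C X m (Idn C (Tob C X)) = vf_add C X n (Idn C (Tob C X))"
      using is_fiber_neg_comp[OF n assms, of "Idn C (Tob C X)"]
        is_fiber_neg_comp[OF m assms, of "Idn C (Tob C X)"] assms a by simp_all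
  qed
  thus ?thesis unfolding fiber_neg_def using n by (metis theI)
qed

text \<open>Later arguments see a difference only through the sum that it solves, so negatives
  disappear from the proof after this point.\<close>

lemma fiber_diff:
  assumes "same_fiber X f g"
  shows "same_fiber X (fiber_diff C X \<cdot> tpair C X f g) g"
    "vf_add C X (fiber_diff C X \<cdot> tpair C X f g) g = f"
proof -
  note P = tpair_props[OF assms] same_fiberD[OF assms]
  let ?n = "fiber_neg C X"
  note n = is_fiber_neg_fiber_neg[OF P(6)]
  have na: "?n \<in> Ar C" "Dom C ?n = Tob C X" "Cod C ?n = Tob C X"
    using n by (auto simp: is_fiber_neg_def Hom_def)
  have s: "same_fiber X (Tpr C 2 X 0) (Tpr C 2 X 1)"
    using P proj_Tpr[of X 0 2 1] by (auto simp: same_fiber_def)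
  have s1: "same_fiber X (Tpr C 2 X 0) (?n \<cdot> Tpr C 2 X 1)"
    by (rule same_fiber_trans[OF s same_fiber_sym]) (use is_fiber_neg_comp[OF n] P in auto)
  have e: "fiber_diff C X \<cdot> tpair C X f g = vf_add C X f (?n \<cdot> g)"
    using vf_add_comp[OF s1, of "tpair C X f g"] P na by (simp add: fiber_diff_def vf_add_def)
  have N: "same_fiber X (?n \<cdot> g) g" "vf_add C X (?n \<cdot> g) g = \<zeta> X \<cdot> (\<pi> X \<cdot> g)"
    using is_fiber_neg_comp[OF n] P by auto
  have s2: "same_fiber X f (?n \<cdot> g)" using same_fiber_trans same_fiber_sym N assms by blast
  show "same_fiber X (fiber_diff C X \<cdot> tpair C X f g) g"
    unfolding e using same_fiber_vf_add s2 assms by blast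
  show "vf_add C X (fiber_diff C X \<cdot> tpair C X f g) g = f"
    unfolding e using vf_add_assoc[OF s2 assms] N vf_add_zero_right[OF assms] by simp
qed

lemma same_fiber_Tar:
  assumes "same_fiber (Dom C h) f g" "h \<in> Ar C" "Cod C h = Y"
  shows "same_fiber Y (Tar C h \<cdot> f) (Tar C h \<cdot> g)"
  using same_fiberD[OF assms(1)] assms(2,3) by (auto simp: same_fiber_def proj_Tar)

text \<open>Naturality of \<alpha> read on points. Below, \<open>h\<close> is often itself a
  structure arrow, such as \<open>\<pi> X\<close>, \<open>\<alpha> X\<close> or a projection;
  tangent maps of all of these are additive.\<close>

lemma Tar_vf_add:
  assumes "same_fiber (Dom C h) f g" "h \<in> Ar C" "Cod C h = Y"
  shows "Tar C h \<cdot> vf_add C (Dom C h) f g = vf_add C Y (Tar C h \<cdot> f) (Tar C h \<cdot> g)"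
proof -
  note P = tpair_props[OF assms(1)] same_fiberD[OF assms(1)]
  let ?X = "Dom C h"
  have s: "same_fiber ?X (Tpr C 2 ?X 0) (Tpr C 2 ?X 1)"
    using P proj_Tpr[of ?X 0 2 1] by (auto simp: same_fiber_def)
  note s' = same_fiber_Tar[OF s assms(2,3)]
  have ax: "Tar C h \<cdot> \<alpha> ?X = vf_add C Y (Tar C h \<cdot> Tpr C 2 ?X 0) (Tar C h \<cdot> Tpr C 2 ?X 1)"
    using fiber_add_natural[of h ?X Y] assms by (auto simp: Hom_def vf_add_def)
  have "Tar C h \<cdot> vf_add C ?X f g = (Tar C h \<cdot> \<alpha> ?X) \<cdot> tpair C ?X f g"
    using P assms by (simp add: vf_add_def)
  also have "\<dots> = vf_add C Y (Tar C h \<cdot> f) (Tar C h \<cdot> g)"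
    unfolding ax by (subst vf_add_comp[OF s']) (use P assms in auto)
  finally show ?thesis .
qed

section \<open>The vertical lift\<close>

lemma flip_flip_comp:
  assumes "X \<in> Ob C" "x \<in> Ar C" "Cod C x = Tob C (Tob C X)"
  shows "\<tau> X \<cdot> (\<tau> X \<cdot> x) = x"
  using comp_eq_comp[OF flip_flip[OF assms(1)], of x] assms by simp

lemma proj_flip_comp:
  assumes "X \<in> Ob C" "x \<in> Ar C" "Cod C x = Tob C (Tob C X)"
  shows "\<pi> (Tob C X) \<cdot> (\<tau> X \<cdot> x) = Tar C (\<pi> X) \<cdot> x"
  using comp_eq_comp[OF proj_flip[OF assms(1)], of x] assms by simp

text \<open>The flip is an involution, so it exchanges the two projections of T (T X) in both
  directions.\<close>

lemma Tproj_flip_comp: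
  assumes "X \<in> Ob C" "x \<in> Ar C" "Cod C x = Tob C (Tob C X)"
  shows "Tar C (\<pi> X) \<cdot> (\<tau> X \<cdot> x) = \<pi> (Tob C X) \<cdot> x"
  using proj_flip_comp[of X "\<tau> X \<cdot> x"] flip_flip_comp[OF assms] assms by simp

lemma flip_lift_comp:
  assumes "X \<in> Ob C" "x \<in> Ar C" "Cod C x = Tob C X"
  shows "\<tau> X \<cdot> (\<ell> X \<cdot> x) = \<ell> X \<cdot> x"
  using comp_eq_comp[OF flip_lift[OF assms(1)], of x] assms by simp

lemma proj_lift_comp:
  assumes "X \<in> Ob C" "x \<in> Ar C" "Cod C x = Tob C X"
  shows "\<pi> (Tob C X) \<cdot> (\<ell> X \<cdot> x) = \<zeta> X \<cdot> (\<pi> X \<cdot> x)"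
  using comp_eq_comp[OF proj_lift[OF assms(1)], of x] assms by simp

text \<open>The flip fixes \<ell> and exchanges the two projections, so both projections take the
  same value on a vertical lift.\<close>

lemma Tproj_lift_comp:
  assumes "X \<in> Ob C" "x \<in> Ar C" "Cod C x = Tob C X"
  shows "Tar C (\<pi> X) \<cdot> (\<ell> X \<cdot> x) = \<zeta> X \<cdot> (\<pi> X \<cdot> x)"
  using proj_flip_comp[of X "\<ell> X \<cdot> x"] flip_lift_comp[OF assms] proj_lift_comp[OF assms] assms
  by simp

lemma proj_Tzero_comp:
  assumes "X \<in> Ob C" "x \<in> Ar C" "Cod C x = Tob C X"
  shows "\<pi> (Tob C X) \<cdot> (Tar C (\<zeta> X) \<cdot> x) = \<zeta> X \<cdot> (\<pi> X \<cdot> x)"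
  using assms by (simp add: proj_Tar)

lemma Tproj_Tzero_comp:
  assumes "X \<in> Ob C" "x \<in> Ar C" "Cod C x = Tob C X"
  shows "Tar C (\<pi> X) \<cdot> (Tar C (\<zeta> X) \<cdot> x) = x"
proof -
  have "\<pi> X \<cdot> \<zeta> X = Idn C X" using proj_zero[of X "Idn C X"] assms(1) by simp
  hence "Tar C (\<pi> X) \<cdot> Tar C (\<zeta> X) = Idn C (Tob C X)"
    using Tar_comp_arr[of "\<zeta> X" "\<pi> X"] assms(1) by (simp add: Tar_idn)
  from comp_eq_comp[OF this, of x] assms show ?thesis by simp
qed

lemma lift_vf_add:
  assumes "same_fiber X f g"
  shows "\<ell> X \<cdot> vf_add C X f g = vf_add C (Tob C X) (\<ell> X \<cdot> f) (\<ell> X \<cdot> g)"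
proof -
  note P = tpair_props[OF assms] same_fiberD[OF assms]
  have s: "same_fiber (Tob C X) (\<ell> X \<cdot> Tpr C 2 X 0) (\<ell> X \<cdot> Tpr C 2 X 1)"
    using P(6) proj_Tpr[of X 0 2 1] by (auto simp: same_fiber_def proj_lift_comp)
  have ax: "vf_add C (Tob C X) (\<ell> X \<cdot> Tpr C 2 X 0) (\<ell> X \<cdot> Tpr C 2 X 1) = \<ell> X \<cdot> \<alpha> X"
    using add_lift[OF P(6)] by (simp only: vf_add_def)
  have "\<ell> X \<cdot> vf_add C X f g = (\<ell> X \<cdot> \<alpha> X) \<cdot> tpair C X f g"
    using P by (simp add: vf_add_def)
  also have "\<dots> = vf_add C (Tob C X) (\<ell> X \<cdot> f) (\<ell> X \<cdot> g)"
    unfolding ax[symmetric] by (subst vf_add_comp[OF s]) (use P in auto)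
  finally show ?thesis .
qed

section \<open>The addition on T (T X) over the tangent map of the projection\<close>

text \<open>The comparison \<open>nu\<close> is a definite description and its inverse another one.
  The universal property is invoked here once, so that later proofs only handle the equations of
  \<open>n\<close> and \<open>m\<close>.\<close>

lemma Tpow2_preserved:
  assumes "X \<in> Ob C"
  obtains P q n m where "is_fiber_power C (Tar C (\<pi> X)) 2 P q"
    "n = nu C 2 X P q" "m = inv_of C n"
    "n \<in> Hom C (Tob C (Tpow C 2 X)) P" "m \<in> Hom C P (Tob C (Tpow C 2 X))"
    "n \<cdot> m = Idn C P" "m \<cdot> n = Idn C (Tob C (Tpow C 2 X))"
    "\<And>i. i < 2 \<Longrightarrow> q i \<cdot> n = Tar C (Tpr C 2 X i)"
proof -
  obtain P q where fp: "is_fiber_power C (Tar C (\<pi> X)) 2 P q" and iso: "is_iso C (nu C 2 X P q)"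
    using Tpow_preserved[OF assms, of 2] by auto
  define n where "n = nu C 2 X P q"
  have "Tar C (\<pi> X) \<cdot> Tar C (Tpr C 2 X i) = Tar C (\<pi> X) \<cdot> Tar C (Tpr C 2 X j)" if "i < 2" "j < 2" for i j
    using that assms proj_Tpr[of X i 2 j] by (simp flip: Tar_comp_arr)
  hence eq: "\<forall>i<2. \<forall>j<2. Tar C (\<pi> X) \<cdot> Tar C (Tpr C 2 X i) = Tar C (\<pi> X) \<cdot> Tar C (Tpr C 2 X j)"
    by blast
  have "Tob C (Tpow C 2 X) \<in> Ob C" using assms Tpow_simps(1)[of X 0 2] by simp
  moreover have "\<forall>i<2. Tar C (Tpr C 2 X i) \<in> Hom C (Tob C (Tpow C 2 X)) (Dom C (Tar C (\<pi> X)))"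
    using assms by (simp add: Hom_def)
  ultimately have "\<exists>!u. u \<in> Hom C (Tob C (Tpow C 2 X)) P \<and> (\<forall>i<2. q i \<cdot> u = Tar C (Tpr C 2 X i))"
    by (rule fiber_power_lift[OF fp _ _ eq])
  from theI'[OF this] have n: "n \<in> Hom C (Tob C (Tpow C 2 X)) P"
    "\<And>i. i < 2 \<Longrightarrow> q i \<cdot> n = Tar C (Tpr C 2 X i)"
    unfolding n_def nu_def fiber_tuple_def by auto
  have "is_inverse C n (inv_of C n)" using is_inverse_inv_of iso n_def by simp
  hence m: "inv_of C n \<in> Hom C P (Tob C (Tpow C 2 X))" "n \<cdot> inv_of C n = Idn C P"
    "inv_of C n \<cdot> n = Idn C (Tob C (Tpow C 2 X))"
    using n(1) by (auto simp: is_inverse_def Hom_def)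
  show ?thesis by (rule that[OF fp n_def refl n(1) m n(2)])
qed

text \<open>The fiber power \<open>P\<close> has the required point \<open>u\<close>, and the
  inverse comparison \<open>m\<close> transports it to \<open>Tob C (Tpow C 2 X)\<close>.\<close>

lemma Tpow2_lift:
  assumes "X \<in> Ob C" "x \<in> Hom C W (Tob C (Tob C X))" "y \<in> Hom C W (Tob C (Tob C X))"
    "Tar C (\<pi> X) \<cdot> x = Tar C (\<pi> X) \<cdot> y"
  obtains z where "z \<in> Hom C W (Tob C (Tpow C 2 X))"
    "Tar C (Tpr C 2 X 0) \<cdot> z = x" "Tar C (Tpr C 2 X 1) \<cdot> z = y"
proof -
  obtain P q n m where fp: "is_fiber_power C (Tar C (\<pi> X)) 2 P q"
    and n: "n \<in> Hom C (Tob C (Tpow C 2 X)) P" and m: "m \<in> Hom C P (Tob C (Tpow C 2 X))"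
    and nm: "n \<cdot> m = Idn C P" and q: "\<And>i. i < 2 \<Longrightarrow> q i \<cdot> n = Tar C (Tpr C 2 X i)"
    using Tpow2_preserved[OF assms(1)] by metis
  let ?h = "\<lambda>i::nat. if i = 0 then x else y"
  have W: "W \<in> Ob C" using assms(2) by (auto simp: Hom_def)
  have "\<exists>!u. u \<in> Hom C W P \<and> (\<forall>i<2. q i \<cdot> u = ?h i)"
    by (rule fiber_power_lift[OF fp W]) (use assms in \<open>simp_all add: Hom_def\<close>)
  then obtain u where u: "u \<in> Hom C W P" and qu: "\<And>i. i < 2 \<Longrightarrow> q i \<cdot> u = ?h i" by blast
  have qa: "q i \<in> Hom C P (Tob C (Tob C X))" if "i < 2" for i
    using fiber_power_proj[OF fp that] assms(1) by simp
  have "Tar C (Tpr C 2 X i) \<cdot> (m \<cdot> u) = ?h i" if "i < 2" for i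
  proof -
    have "Tar C (Tpr C 2 X i) \<cdot> (m \<cdot> u) = q i \<cdot> ((n \<cdot> m) \<cdot> u)"
      unfolding q[OF that, symmetric] using n m u qa[OF that] by (simp add: Hom_def)
    thus ?thesis using u qu[OF that] nm by (simp add: Hom_def)
  qed
  from this[of 0] this[of 1] show ?thesis
    using u m by (intro that[of "m \<cdot> u"]) (auto simp: Hom_def)
qed

text \<open>This is \<open>add_flip\<close> with the comparison arrow eliminated:
  \<open>Tar C (\<alpha> X)\<close> is the addition over \<open>Tar C (\<pi> X)\<close>, and
  conjugation by the flip turns it into the addition over \<open>\<pi> (Tob C X)\<close>.\<close>

lemma Tadd_comp:
  assumes "X \<in> Ob C" "z \<in> Ar C" "Cod C z = Tob C (Tpow C 2 X)"
  shows "Tar C (\<alpha> X) \<cdot> z = \<tau> X \<cdot> vf_add C (Tob C X)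
    (\<tau> X \<cdot> (Tar C (Tpr C 2 X 0) \<cdot> z)) (\<tau> X \<cdot> (Tar C (Tpr C 2 X 1) \<cdot> z))"
proof -
  obtain P q n m where fp: "is_fiber_power C (Tar C (\<pi> X)) 2 P q"
    and nd: "n = nu C 2 X P q" and md: "m = inv_of C n"
    and n: "n \<in> Hom C (Tob C (Tpow C 2 X)) P" and m: "m \<in> Hom C P (Tob C (Tpow C 2 X))"
    and mn: "m \<cdot> n = Idn C (Tob C (Tpow C 2 X))" and q: "\<And>i. i < 2 \<Longrightarrow> q i \<cdot> n = Tar C (Tpr C 2 X i)"
    using Tpow2_preserved[OF assms(1)] by metis
  have qa: "q i \<in> Hom C P (Tob C (Tob C X))" if "i < 2" for i
    using fiber_power_proj[OF fp that] assms(1) by simp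
  note q01 = qa[of 0, simplified] qa[of 1, simplified]
  have "Tar C (\<pi> X) \<cdot> q 0 = Tar C (\<pi> X) \<cdot> q 1"
    by (rule fiber_power_proj_eq[OF fp]) simp_all
  hence s: "same_fiber (Tob C X) (\<tau> X \<cdot> q 0) (\<tau> X \<cdot> q 1)"
    using q01 assms(1) by (auto simp: same_fiber_def proj_flip_comp Hom_def)
  have ax: "vf_add C (Tob C X) (\<tau> X \<cdot> q 0) (\<tau> X \<cdot> q 1) = \<tau> X \<cdot> (Tar C (\<alpha> X) \<cdot> m)"
    using add_flip[OF assms(1) fp] by (simp only: vf_add_def nd md)
  have e: "q i \<cdot> (n \<cdot> z) = Tar C (Tpr C 2 X i) \<cdot> z" if "i < 2" for i
    using comp_eq_comp[OF q[OF that], of z] qa[OF that] n assms by (simp add: Hom_def)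
  \<comment> \<open>Inserting \<open>m \<cdot> n\<close> and a double flip exposes the right side of
    \<open>ax\<close>, evaluated at the point \<open>n \<cdot> z\<close>.\<close>
  have "Tar C (\<alpha> X) \<cdot> z = Tar C (\<alpha> X) \<cdot> ((m \<cdot> n) \<cdot> z)"
    using assms by (simp add: mn)
  also have "\<dots> = \<tau> X \<cdot> (\<tau> X \<cdot> (Tar C (\<alpha> X) \<cdot> (m \<cdot> (n \<cdot> z))))"
    using assms n m by (simp add: flip_flip_comp Hom_def)
  also have "\<dots> = \<tau> X \<cdot> ((\<tau> X \<cdot> (Tar C (\<alpha> X) \<cdot> m)) \<cdot> (n \<cdot> z))"
    using assms n m by (simp add: Hom_def)
  also have "\<dots> = \<tau> X \<cdot> vf_add C (Tob C X)
    (\<tau> X \<cdot> (Tar C (Tpr C 2 X 0) \<cdot> z)) (\<tau> X \<cdot> (Tar C (Tpr C 2 X 1) \<cdot> z))"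
    unfolding ax[symmetric]
    by (subst vf_add_comp[OF s])
      (use assms n q01 e[of 0] e[of 1] in \<open>simp_all add: Hom_def\<close>)
  finally show ?thesis .
qed

section \<open>The extended vertical lift\<close>

lemma same_fiber_lift2:
  assumes "same_fiber X a b"
  shows "same_fiber (Tob C X) (Tar C (\<zeta> X) \<cdot> a) (\<ell> X \<cdot> b)"
  using same_fiberD[OF assms] by (auto simp: same_fiber_def proj_Tzero_comp proj_lift_comp)

lemma vert_lift2_tpair:
  assumes "same_fiber X a b"
  shows "vert_lift2 C X \<cdot> tpair C X a b = \<tau> X \<cdot> vf_add C (Tob C X) (Tar C (\<zeta> X) \<cdot> a) (\<ell> X \<cdot> b)"
proof -
  note P = tpair_props[OF assms] same_fiberD[OF assms]
  have s: "same_fiber X (Tpr C 2 X 0) (Tpr C 2 X 1)"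
    using P(6) proj_Tpr[of X 0 2 1] by (auto simp: same_fiber_def)
  have "vert_lift2 C X \<cdot> tpair C X a b = \<tau> X \<cdot> (vf_add C (Tob C X)
     (Tar C (\<zeta> X) \<cdot> Tpr C 2 X 0) (\<ell> X \<cdot> Tpr C 2 X 1) \<cdot> tpair C X a b)"
    using P vf_add_typing[OF same_fiber_lift2[OF s]] by (simp add: vert_lift2_def flip: vf_add_def)
  also have "\<dots> = \<tau> X \<cdot> vf_add C (Tob C X) (Tar C (\<zeta> X) \<cdot> a) (\<ell> X \<cdot> b)"
    by (subst vf_add_comp[OF same_fiber_lift2[OF s]]) (use P in auto)
  finally show ?thesis .
qed

lemma vert_lift2_tpair_typing:
  assumes "same_fiber X a b"
  shows "vert_lift2 C X \<cdot> tpair C X a b \<in> Ar C" "Dom C (vert_lift2 C X \<cdot> tpair C X a b) = Dom C a"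
    "Cod C (vert_lift2 C X \<cdot> tpair C X a b) = Tob C (Tob C X)"
    "Tar C (\<pi> X) \<cdot> (vert_lift2 C X \<cdot> tpair C X a b) = \<zeta> X \<cdot> (\<pi> X \<cdot> a)"
    "\<pi> (Tob C X) \<cdot> (vert_lift2 C X \<cdot> tpair C X a b) = a"
proof -
  note D = same_fiberD[OF assms]
  note s = same_fiber_lift2[OF assms]
  note [simp] = vf_add_typing[OF s]
  show "vert_lift2 C X \<cdot> tpair C X a b \<in> Ar C" "Dom C (vert_lift2 C X \<cdot> tpair C X a b) = Dom C a"
    "Cod C (vert_lift2 C X \<cdot> tpair C X a b) = Tob C (Tob C X)"
    using D by (simp_all add: vert_lift2_tpair[OF assms])
  show "Tar C (\<pi> X) \<cdot> (vert_lift2 C X \<cdot> tpair C X a b) = \<zeta> X \<cdot> (\<pi> X \<cdot> a)"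
    using D by (simp add: vert_lift2_tpair[OF assms] Tproj_flip_comp proj_vf_add[OF s] proj_Tzero_comp)
  \<comment> \<open>After the flip the projection becomes \<open>Tar C (\<pi> X)\<close>, which is
    additive. It recovers \<open>a\<close> from the first summand and sends the lift of
    \<open>b\<close> to a zero.\<close>
  have "\<pi> (Tob C X) \<cdot> (vert_lift2 C X \<cdot> tpair C X a b) =
    vf_add C X (Tar C (\<pi> X) \<cdot> (Tar C (\<zeta> X) \<cdot> a)) (Tar C (\<pi> X) \<cdot> (\<ell> X \<cdot> b))"
    using D s Tar_vf_add[of "\<pi> X" _ _ X] by (simp add: vert_lift2_tpair[OF assms] proj_flip_comp)
  also have "\<dots> = a" using D vf_add_zero_right[OF assms] by (simp add: Tproj_Tzero_comp Tproj_lift_comp)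
  finally show "\<pi> (Tob C X) \<cdot> (vert_lift2 C X \<cdot> tpair C X a b) = a" .
qed

text \<open>Interchange of the two additions on \<open>T (T X)\<close>: the flip turns the addition over
  \<open>\<pi>\<^bsub>T X\<^esub>\<close> into \<open>T \<alpha>\<^sub>X\<close>, which preserves the former by naturality of addition.\<close>

lemma vert_lift2_add:
  assumes "same_fiber X a b" "same_fiber X a c"
  shows "vf_add C (Tob C X) (vert_lift2 C X \<cdot> tpair C X a b) (vert_lift2 C X \<cdot> tpair C X a c)
    = vert_lift2 C X \<cdot> tpair C X a (vf_add C X b c)"
proof -
  note D = same_fiberD[OF assms(1)] same_fiberD[OF assms(2)]
  let ?TX = "Tob C X" and ?X2 = "Tpow C 2 X" and ?p = "Tpr C 2 X"
  have X2: "?X2 \<in> Ob C" using D(1) Tpow_simps(1)[of X 0 2] by simp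
  have bc: "same_fiber X b c" using assms same_fiber_sym same_fiber_trans by blast
  have abc: "same_fiber X a (vf_add C X b c)" using same_fiber_vf_add bc assms same_fiber_sym by blast
  note s = same_fiber_lift2[OF assms(1)] same_fiber_lift2[OF assms(2)] same_fiber_lift2[OF abc]
  have zz: "same_fiber X (\<zeta> X) (\<zeta> X)" using D(1) by (simp add: same_fiber_def)
  note zp = tpair_props[OF zz]
  have zadd: "vf_add C X (\<zeta> X) (\<zeta> X) = \<zeta> X"
    using vf_add_zero_left[of X "\<zeta> X"] proj_zero[of X "Idn C X"] D(1) by simp
  \<comment> \<open>One side of the array: both components are
    \<open>Tar C (\<zeta> X) \<cdot> a\<close>. Writing it as a tangent map lets functoriality
    compute \<open>Tar C (\<alpha> X) \<cdot> z\<close> from the fact that zero plus zero is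
    zero.\<close>
  define z where "z = Tar C (tpair C X (\<zeta> X) (\<zeta> X)) \<cdot> a"
  have z: "z \<in> Ar C" "Dom C z = Dom C a" "Cod C z = Tob C ?X2"
    using zp D by (simp_all add: z_def)
  have pz: "Tar C (?p i) \<cdot> z = Tar C (\<zeta> X) \<cdot> a" if "i < 2" for i
  proof -
    have "?p i \<cdot> tpair C X (\<zeta> X) (\<zeta> X) = \<zeta> X"
      using zp that less_2_cases by force
    hence "Tar C (?p i) \<cdot> Tar C (tpair C X (\<zeta> X) (\<zeta> X)) = Tar C (\<zeta> X)"
      using Tar_comp_arr[of "tpair C X (\<zeta> X) (\<zeta> X)" "?p i"] zp that D(1) by simp
    from comp_eq_comp[OF this, of a] show ?thesis using zp that D by (simp add: z_def)
  qed
  have "\<alpha> X \<cdot> tpair C X (\<zeta> X) (\<zeta> X) = \<zeta> X" using zadd by (simp add: vf_add_def)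
  hence "Tar C (\<alpha> X) \<cdot> Tar C (tpair C X (\<zeta> X) (\<zeta> X)) = Tar C (\<zeta> X)"
    using Tar_comp_arr[of "tpair C X (\<zeta> X) (\<zeta> X)" "\<alpha> X"] zp D(1) by simp
  from comp_eq_comp[OF this, of a] have az: "Tar C (\<alpha> X) \<cdot> z = Tar C (\<zeta> X) \<cdot> a"
    using zp D by (simp add: z_def)
  \<comment> \<open>The other side, with components \<open>\<ell> X \<cdot> b\<close> and
    \<open>\<ell> X \<cdot> c\<close>. These are not given as tangent maps applied to a common
    arrow, so the point comes from the preserved fiber product.\<close>
  obtain y where y: "y \<in> Hom C (Dom C a) (Tob C ?X2)"
    and py: "Tar C (?p 0) \<cdot> y = \<ell> X \<cdot> b" "Tar C (?p 1) \<cdot> y = \<ell> X \<cdot> c"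
    using Tpow2_lift[of X "\<ell> X \<cdot> b" "Dom C a" "\<ell> X \<cdot> c"] D by (auto simp: Hom_def Tproj_lift_comp)
  have ay: "Tar C (\<alpha> X) \<cdot> y = \<ell> X \<cdot> vf_add C X b c"
    using Tadd_comp[of X y] y py D bc
    by (simp add: Hom_def flip_lift_comp flip: lift_vf_add del: One_nat_def)
  \<comment> \<open>Naturality of \<pi> computes base points in T_2 X componentwise. Those of
    \<open>z\<close> and \<open>y\<close> are both the pair of zeros over
    \<open>\<pi> X \<cdot> a\<close>, so \<open>z\<close> and \<open>y\<close> can be added.\<close>
  have pp: "?p i \<cdot> (\<pi> ?X2 \<cdot> u) = \<pi> ?TX \<cdot> (Tar C (?p i) \<cdot> u)"
    if "i < 2" "u \<in> Ar C" "Cod C u = Tob C ?X2" for i u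
    using proj_Tar[of "?p i" u ?TX] that D(1) by simp
  have ppz: "?p i \<cdot> (\<pi> ?X2 \<cdot> z) = \<zeta> X \<cdot> (\<pi> X \<cdot> a)" if "i < 2" for i
    using that D z by (simp add: pp pz proj_Tzero_comp)
  have ppy: "?p 0 \<cdot> (\<pi> ?X2 \<cdot> y) = \<zeta> X \<cdot> (\<pi> X \<cdot> a)" "?p 1 \<cdot> (\<pi> ?X2 \<cdot> y) = \<zeta> X \<cdot> (\<pi> X \<cdot> a)"
    using D y py by (simp_all add: pp proj_lift_comp Hom_def del: One_nat_def)
  have sz: "same_fiber X (\<zeta> X \<cdot> (\<pi> X \<cdot> a)) (\<zeta> X \<cdot> (\<pi> X \<cdot> a))"
    using D by (simp add: same_fiber_def)
  have "\<pi> ?X2 \<cdot> z = tpair C X (\<zeta> X \<cdot> (\<pi> X \<cdot> a)) (\<zeta> X \<cdot> (\<pi> X \<cdot> a))"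
    by (rule tpair_unique[OF sz]) (use z D X2 ppz in auto)
  moreover have "\<pi> ?X2 \<cdot> y = tpair C X (\<zeta> X \<cdot> (\<pi> X \<cdot> a)) (\<zeta> X \<cdot> (\<pi> X \<cdot> a))"
    by (rule tpair_unique[OF sz]) (use y D X2 ppy in \<open>auto simp: Hom_def\<close>)
  ultimately have szy: "same_fiber ?X2 z y"
    using z y X2 by (simp add: same_fiber_def Hom_def)
  define t where "t = vf_add C ?X2 z y"
  have t: "t \<in> Ar C" "Dom C t = Dom C a" "Cod C t = Tob C ?X2"
    using vf_add_typing[OF szy] z by (simp_all add: t_def)
  have pt: "Tar C (?p 0) \<cdot> t = vf_add C ?TX (Tar C (\<zeta> X) \<cdot> a) (\<ell> X \<cdot> b)"
    "Tar C (?p 1) \<cdot> t = vf_add C ?TX (Tar C (\<zeta> X) \<cdot> a) (\<ell> X \<cdot> c)"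
    using Tar_vf_add[of "?p 0" z y ?TX] Tar_vf_add[of "?p 1" z y ?TX] szy D(1) py pz
    by (simp_all add: t_def)
  \<comment> \<open>\<open>Tar C (\<alpha> X) \<cdot> t\<close> is evaluated twice: through the
    components of \<open>t\<close>, which are the flipped lifts, and through the summands
    \<open>z\<close> and \<open>y\<close>, on which it is additive.\<close>
  have "\<tau> X \<cdot> vf_add C ?TX (vert_lift2 C X \<cdot> tpair C X a b) (vert_lift2 C X \<cdot> tpair C X a c)
    = Tar C (\<alpha> X) \<cdot> t"
    using Tadd_comp[OF D(1) t(1,3)] pt by (simp add: vert_lift2_tpair assms)
  also have "\<dots> = vf_add C ?TX (Tar C (\<zeta> X) \<cdot> a) (\<ell> X \<cdot> vf_add C X b c)"
    using Tar_vf_add[of "\<alpha> X" z y ?TX] szy D(1) az ay by (simp add: t_def)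
  finally have "\<tau> X \<cdot> (\<tau> X \<cdot> vf_add C ?TX (vert_lift2 C X \<cdot> tpair C X a b) (vert_lift2 C X \<cdot> tpair C X a c))
    = vert_lift2 C X \<cdot> tpair C X a (vf_add C X b c)"
    by (simp add: vert_lift2_tpair abc)
  moreover have "same_fiber ?TX (vert_lift2 C X \<cdot> tpair C X a b) (vert_lift2 C X \<cdot> tpair C X a c)"
    using vert_lift2_tpair_typing[OF assms(1)] vert_lift2_tpair_typing[OF assms(2)] D(1)
    by (simp add: same_fiber_def)
  ultimately show ?thesis using flip_flip_comp D(1) by simp
qed

section \<open>Consequences of the pullback square of the vertical lift\<close>

text \<open>The legs of the pullback are \<ell> and \<pi>, so within one fiber \<ell> alone
  separates points.\<close>

lemma lift_monic:
  assumes "same_fiber X b c" "\<ell> X \<cdot> b = \<ell> X \<cdot> c"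
  shows "b = c"
  by (rule pullback_eqI[OF lift_pullback]) (use same_fiberD[OF assms(1)] assms(2) in auto)

text \<open>The existence half of the same pullback, with the equation in T_2 X split into its two
  components.\<close>

lemma lift_factor:
  assumes "X \<in> Ob C" "e \<in> Hom C W (Tob C (Tob C X))" "p \<in> Hom C W X"
    "\<pi> (Tob C X) \<cdot> e = \<zeta> X \<cdot> p" "Tar C (\<pi> X) \<cdot> e = \<zeta> X \<cdot> p"
  obtains u where "u \<in> Hom C W (Tob C X)" "\<ell> X \<cdot> u = e" "\<pi> X \<cdot> u = p"
proof -
  have s1: "same_fiber X (\<pi> (Tob C X)) (Tar C (\<pi> X))"
    using assms(1) bundle_proj_natural[of "\<pi> X" "Tob C X" X] by (simp add: same_fiber_def Hom_def)
  have s2: "same_fiber X (\<zeta> X) (\<zeta> X)" using assms(1) by (simp add: same_fiber_def)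
  note P = tpair_props[OF s1] tpair_props[OF s2]
  have "tpair C X (\<pi> (Tob C X)) (Tar C (\<pi> X)) \<cdot> e = tpair C X (\<zeta> X) (\<zeta> X) \<cdot> p"
    using tpair_comp[OF s1, of e] tpair_comp[OF s2, of p] assms by (simp add: Hom_def)
  with pullback_lift[OF lift_pullback[OF assms(1)], of e W p] have
    "\<exists>!u. u \<in> Hom C W (Tob C X) \<and> \<ell> X \<cdot> u = e \<and> \<pi> X \<cdot> u = p"
    using P assms by (simp add: Hom_def)
  thus ?thesis using that by blast
qed

text \<open>Removing the flip and the common summand leaves an equation between vertical lifts in
  one fiber. This is what makes the bracket unique.\<close>

lemma vert_lift2_cancel:
  assumes "same_fiber X a b" "same_fiber X a c"
    "vert_lift2 C X \<cdot> tpair C X a b = vert_lift2 C X \<cdot> tpair C X a c"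
  shows "b = c"
proof (rule lift_monic)
  note s = same_fiber_lift2[OF assms(1)] same_fiber_lift2[OF assms(2)]
  show bc: "same_fiber X b c" using assms same_fiber_sym same_fiber_trans by blast
  have "\<tau> X \<cdot> (vert_lift2 C X \<cdot> tpair C X a b) = \<tau> X \<cdot> (vert_lift2 C X \<cdot> tpair C X a c)"
    by (simp only: assms(3))
  hence "vf_add C (Tob C X) (Tar C (\<zeta> X) \<cdot> a) (\<ell> X \<cdot> b) = vf_add C (Tob C X) (Tar C (\<zeta> X) \<cdot> a) (\<ell> X \<cdot> c)"
    using same_fiberD(1)[OF bc] s by (simp add: vert_lift2_tpair assms(1,2) flip_flip_comp)
  hence "vf_add C (Tob C X) (\<ell> X \<cdot> b) (Tar C (\<zeta> X) \<cdot> a) = vf_add C (Tob C X) (\<ell> X \<cdot> c) (Tar C (\<zeta> X) \<cdot> a)"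
    by (simp only: vf_add_commute[OF s(1)] vf_add_commute[OF s(2)])
  thus "\<ell> X \<cdot> b = \<ell> X \<cdot> c" using vf_add_cancel s same_fiber_sym by blast
qed

section \<open>The bracket\<close>

lemma vector_fieldsD:
  assumes "v \<in> vector_fields C X"
  shows "v \<in> Ar C" "Dom C v = X" "Cod C v = Tob C X" "\<pi> X \<cdot> v = Idn C X" "X \<in> Ob C"
  using assms by (auto simp: vector_fields_def Hom_def)

lemma Tproj_Tar_vector_field:
  assumes "v \<in> vector_fields C X" "x \<in> Ar C" "Cod C x = Tob C X"
  shows "Tar C (\<pi> X) \<cdot> (Tar C v \<cdot> x) = x"
proof -
  note V = vector_fieldsD[OF assms(1)]
  have "Tar C (\<pi> X) \<cdot> Tar C v = Idn C (Tob C X)"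
    using V Tar_comp_arr[of v "\<pi> X"] by (simp add: Tar_idn)
  from comp_eq_comp[OF this, of x] show ?thesis using V assms(2,3) by simp
qed

lemma same_fiber_vector_fields:
  assumes "v \<in> vector_fields C X" "w \<in> vector_fields C X"
  shows "same_fiber X v w"
  using vector_fieldsD[OF assms(1)] vector_fieldsD[OF assms(2)] by (simp add: same_fiber_def)

text \<open>Both arrows lie over \<open>w\<close>: the first by naturality of \<pi>, the second
  because the flip turns \<pi> into \<open>Tar C (\<pi> X)\<close>, and \<open>Tar C v\<close> is a
  section of the latter.\<close>

lemma same_fiber_vf_delta:
  assumes "v \<in> vector_fields C X" "w \<in> vector_fields C X"
  shows "same_fiber (Tob C X) (Tar C w \<cdot> v) (\<tau> X \<cdot> (Tar C v \<cdot> w))"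
  using vector_fieldsD[OF assms(1)] vector_fieldsD[OF assms(2)] Tproj_Tar_vector_field[OF assms(1)]
  by (simp add: same_fiber_def proj_Tar proj_flip_comp)

lemma vf_delta:
  assumes "v \<in> vector_fields C X" "w \<in> vector_fields C X"
  shows "same_fiber (Tob C X) (vf_delta C X v w) (\<tau> X \<cdot> (Tar C v \<cdot> w))"
    "vf_add C (Tob C X) (vf_delta C X v w) (\<tau> X \<cdot> (Tar C v \<cdot> w)) = Tar C w \<cdot> v"
  using fiber_diff[OF same_fiber_vf_delta[OF assms]] by (simp_all add: vf_delta_def)

lemma vf_bracket_eqI:
  assumes "w \<in> vector_fields C X" "u \<in> vector_fields C X"
    "vf_delta C X v w = vert_lift2 C X \<cdot> tpair C X w u"
  shows "vf_bracket C X v w = u"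
  unfolding vf_bracket_def
proof (rule the_equality)
  fix u' assume u': "u' \<in> vector_fields C X \<and> vf_delta C X v w = vert_lift2 C X \<cdot> tpair C X w u'"
  show "u' = u"
    by (rule vert_lift2_cancel[of X w])
      (use u' assms same_fiber_vector_fields in auto)
qed (use assms in simp)

text \<open>Existence of the bracket: the equation is solved for the vertical lift of the unknown
  field, and the solution factors through \<ell> because both of its projections are zero.\<close>

lemma vf_bracket:
  assumes "v \<in> vector_fields C X" "w \<in> vector_fields C X"
  shows "vf_bracket C X v w \<in> vector_fields C X"
    "vf_delta C X v w = vert_lift2 C X \<cdot> tpair C X w (vf_bracket C X v w)"
proof -
  note V = vector_fieldsD[OF assms(1)] and W = vector_fieldsD[OF assms(2)]
  let ?TX = "Tob C X" and ?d = "vf_delta C X v w" and ?y = "\<tau> X \<cdot> (Tar C v \<cdot> w)"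
  note sd = same_fiber_vf_delta[OF assms]
  note d = vf_delta[OF assms]
  note D = same_fiberD[OF d(1)]
  have Dd: "Dom C ?d = X" using D(4) V W by simp
  have pd: "\<pi> ?TX \<cdot> ?d = w"
    using D(7) same_fiberD(7)[OF sd] V W by (simp add: proj_Tar)
  have zv: "same_fiber X (\<zeta> X) v"
    using V proj_zero[of X "Idn C X"] by (simp add: same_fiber_def)
  \<comment> \<open>The additive map \<open>Tar C (\<pi> X)\<close> turns
    \<open>?d + ?y = Tar C w \<cdot> v\<close> into an equation of the form s + v = v, so the image
    s of \<open>?d\<close> is the zero section.\<close>
  have "Tar C (\<pi> X) \<cdot> ?y = v" using V W by (simp add: Tproj_flip_comp proj_Tar)
  moreover have "Tar C (\<pi> X) \<cdot> (Tar C w \<cdot> v) = v"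
    using Tproj_Tar_vector_field[OF assms(2)] V by simp
  ultimately have e: "vf_add C X (Tar C (\<pi> X) \<cdot> ?d) v = v"
    and s: "same_fiber X (Tar C (\<pi> X) \<cdot> ?d) v"
    using Tar_vf_add[of "\<pi> X" ?d ?y X] same_fiber_Tar[of "\<pi> X" ?d ?y X] d V(5) by simp_all
  have "vf_add C X (\<zeta> X) v = v" using vf_add_zero_left[of X v] V by simp
  with e have Td: "Tar C (\<pi> X) \<cdot> ?d = \<zeta> X" using vf_add_cancel[OF s zv] by simp
  let ?z = "Tar C (\<zeta> X) \<cdot> w"
  have sz: "same_fiber ?TX (\<tau> X \<cdot> ?d) ?z"
    using V W D Dd Td by (simp add: same_fiber_def proj_flip_comp proj_Tzero_comp)
  \<comment> \<open>If \<open>?d\<close> is the extended lift of \<open>w\<close> and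
    \<open>u\<close>, then \<open>\<tau> X \<cdot> ?d\<close> is \<open>?z\<close> plus
    \<open>\<ell> X \<cdot> u\<close>. So \<open>e\<close> is the only candidate for
    \<open>\<ell> X \<cdot> u\<close>.\<close>
  define e where "e = fiber_diff C ?TX \<cdot> tpair C ?TX (\<tau> X \<cdot> ?d) ?z"
  have es: "same_fiber ?TX e ?z" and ez: "vf_add C ?TX e ?z = \<tau> X \<cdot> ?d"
    using fiber_diff[OF sz] by (simp_all add: e_def)
  note E = same_fiberD[OF es]
  have ea: "e \<in> Hom C X (Tob C ?TX)" using E V W by (simp add: Hom_def)
  have pe: "\<pi> ?TX \<cdot> e = \<zeta> X \<cdot> Idn C X" using E(7) V W by (simp add: proj_Tzero_comp)
  \<comment> \<open>The cancellation used for \<open>?d\<close> is repeated with \<open>w\<close> in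
    the role of \<open>v\<close>: \<open>Tar C (\<pi> X)\<close> sends both \<open>?z\<close> and
    \<open>\<tau> X \<cdot> ?d\<close> to \<open>w\<close>.\<close>
  have "Tar C (\<pi> X) \<cdot> ?z = w" using V W by (simp add: Tproj_Tzero_comp)
  moreover have "Tar C (\<pi> X) \<cdot> (\<tau> X \<cdot> ?d) = w" using V D pd by (simp add: Tproj_flip_comp)
  ultimately have e': "vf_add C X (Tar C (\<pi> X) \<cdot> e) w = w" and s': "same_fiber X (Tar C (\<pi> X) \<cdot> e) w"
    using Tar_vf_add[of "\<pi> X" e ?z X] same_fiber_Tar[of "\<pi> X" e ?z X] es ez V(5) by simp_all
  have zw: "same_fiber X (\<zeta> X) w"
    using W proj_zero[of X "Idn C X"] by (simp add: same_fiber_def)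
  have "vf_add C X (\<zeta> X) w = w" using vf_add_zero_left[of X w] W by simp
  with e' have Te: "Tar C (\<pi> X) \<cdot> e = \<zeta> X \<cdot> Idn C X" using vf_add_cancel[OF s' zw] V by simp
  obtain u where u: "u \<in> Hom C X (Tob C X)" "\<ell> X \<cdot> u = e" "\<pi> X \<cdot> u = Idn C X"
    using lift_factor[OF V(5) ea idn[OF V(5)] pe Te] by blast
  hence uv: "u \<in> vector_fields C X" by (simp add: vector_fields_def)
  have "?d = \<tau> X \<cdot> (\<tau> X \<cdot> ?d)" using D V by (simp add: flip_flip_comp)
  also have "\<dots> = vert_lift2 C X \<cdot> tpair C X w u"
    unfolding vert_lift2_tpair[OF same_fiber_vector_fields[OF assms(2) uv]] u(2)
    using vf_add_commute[OF es] ez by simp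
  finally have "?d = vert_lift2 C X \<cdot> tpair C X w u" .
  with uv vf_bracket_eqI[OF assms(2) uv] show "vf_bracket C X v w \<in> vector_fields C X"
    "?d = vert_lift2 C X \<cdot> tpair C X w (vf_bracket C X v w)" by simp_all
qed

end

section \<open>Tangent morphisms of products\<close>

context cartesian_tangent_category
begin

lemma prod_simps [simp]:
  assumes "X \<in> Ob C" "Y \<in> Ob C"
  shows "X \<otimes> Y \<in> Ob C"
    "pr1 C X Y \<in> Ar C" "Dom C (pr1 C X Y) = X \<otimes> Y" "Cod C (pr1 C X Y) = X"
    "pr2 C X Y \<in> Ar C" "Dom C (pr2 C X Y) = X \<otimes> Y" "Cod C (pr2 C X Y) = Y"
  using Prod[OF assms] pr1[OF assms] pr2[OF assms] by (auto simp: Hom_def)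

lemma pair_props:
  assumes "f \<in> Ar C" "g \<in> Ar C" "Dom C f = Dom C g"
  shows "\<langle>f, g\<rangle> \<in> Ar C \<and> Dom C \<langle>f, g\<rangle> = Dom C f \<and> Cod C \<langle>f, g\<rangle> = Cod C f \<otimes> Cod C g \<and>
    pr1 C (Cod C f) (Cod C g) \<cdot> \<langle>f, g\<rangle> = f \<and> pr2 C (Cod C f) (Cod C g) \<cdot> \<langle>f, g\<rangle> = g"
proof -
  have "f \<in> Hom C (Dom C f) (Cod C f)" "g \<in> Hom C (Dom C f) (Cod C g)"
    using assms by (auto simp: Hom_def)
  from theI'[OF Prod_universal[OF this], folded pair_def] show ?thesis by (simp add: Hom_def)
qed

lemma pair_simps [simp]:
  assumes "f \<in> Ar C" "g \<in> Ar C" "Dom C f = Dom C g"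
  shows "\<langle>f, g\<rangle> \<in> Ar C" "Dom C \<langle>f, g\<rangle> = Dom C f" "Cod C \<langle>f, g\<rangle> = Cod C f \<otimes> Cod C g"
    "Cod C f = A \<Longrightarrow> Cod C g = B \<Longrightarrow> pr1 C A B \<cdot> \<langle>f, g\<rangle> = f"
    "Cod C f = A \<Longrightarrow> Cod C g = B \<Longrightarrow> pr2 C A B \<cdot> \<langle>f, g\<rangle> = g"
  using pair_props[OF assms] by auto

lemma prod_eqI:
  assumes "X \<in> Ob C" "Y \<in> Ob C" "u \<in> Ar C" "u' \<in> Ar C" "Dom C u = Dom C u'"
    "Cod C u = X \<otimes> Y" "Cod C u' = X \<otimes> Y"
    "pr1 C X Y \<cdot> u = pr1 C X Y \<cdot> u'" "pr2 C X Y \<cdot> u = pr2 C X Y \<cdot> u'"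
  shows "u = u'"
proof -
  have "pr1 C X Y \<cdot> u' \<in> Hom C (Dom C u') X" "pr2 C X Y \<cdot> u' \<in> Hom C (Dom C u') Y"
    using assms(1-7) by (auto simp: Hom_def)
  from Prod_universal[OF this] have
    "\<exists>!t. t \<in> Hom C (Dom C u') (X \<otimes> Y) \<and> pr1 C X Y \<cdot> t = pr1 C X Y \<cdot> u' \<and> pr2 C X Y \<cdot> t = pr2 C X Y \<cdot> u'" .
  moreover have "u \<in> Hom C (Dom C u') (X \<otimes> Y)" "u' \<in> Hom C (Dom C u') (X \<otimes> Y)"
    using assms(1-7) by (auto simp: Hom_def)
  ultimately show ?thesis using assms(8,9) by blast
qed

lemma pair_comp [simp]:
  assumes "f \<in> Ar C" "g \<in> Ar C" "Dom C f = Dom C g" "h \<in> Ar C" "Cod C h = Dom C g"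
  shows "\<langle>f, g\<rangle> \<cdot> h = \<langle>f \<cdot> h, g \<cdot> h\<rangle>"
proof (rule prod_eqI)
  show "pr1 C (Cod C f) (Cod C g) \<cdot> (\<langle>f, g\<rangle> \<cdot> h) = pr1 C (Cod C f) (Cod C g) \<cdot> \<langle>f \<cdot> h, g \<cdot> h\<rangle>"
    using comp_eq_comp[of "pr1 C (Cod C f) (Cod C g)" "\<langle>f, g\<rangle>" f h] assms by simp
  show "pr2 C (Cod C f) (Cod C g) \<cdot> (\<langle>f, g\<rangle> \<cdot> h) = pr2 C (Cod C f) (Cod C g) \<cdot> \<langle>f \<cdot> h, g \<cdot> h\<rangle>"
    using comp_eq_comp[of "pr2 C (Cod C f) (Cod C g)" "\<langle>f, g\<rangle>" g h] assms by simp
qed (use assms in simp_all)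

lemma prod_map_pair [simp]:
  assumes "f \<in> Ar C" "g \<in> Ar C" "a \<in> Ar C" "b \<in> Ar C" "Dom C a = Dom C b"
    "Cod C a = Dom C f" "Cod C b = Dom C g"
  shows "prod_map C f g \<cdot> \<langle>a, b\<rangle> = \<langle>f \<cdot> a, g \<cdot> b\<rangle>"
  using assms by (simp add: prod_map_def)

lemma prod_map_simps [simp]:
  assumes "f \<in> Ar C" "g \<in> Ar C"
  shows "prod_map C f g \<in> Ar C" "Dom C (prod_map C f g) = Dom C f \<otimes> Dom C g"
    "Cod C (prod_map C f g) = Cod C f \<otimes> Cod C g"
  using assms by (simp_all add: prod_map_def)

lemma to_One_simps [simp]:
  assumes "X \<in> Ob C"
  shows "to_One C X \<in> Ar C" "Dom C (to_One C X) = X" "Cod C (to_One C X) = One C"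
  using theI'[OF One_terminal[OF assms], folded to_One_def] by (auto simp: Hom_def)

lemma to_One_comp:
  assumes "h \<in> Ar C" "Cod C h = X"
  shows "to_One C X \<cdot> h = to_One C (Dom C h)"
proof -
  have "to_One C X \<cdot> h \<in> Hom C (Dom C h) (One C)" "to_One C (Dom C h) \<in> Hom C (Dom C h) (One C)"
    using assms by (auto simp: Hom_def)
  thus ?thesis using One_terminal[of "Dom C h"] assms by auto
qed

text \<open>The point of \<open>Tob C (A \<otimes> B)\<close> with components \<open>a\<close> and
  \<open>b\<close>. The factors are arguments because their tangent objects do not determine
  them.\<close>

definition Tpair :: "'o \<Rightarrow> 'o \<Rightarrow> 'm \<Rightarrow> 'm \<Rightarrow> 'm" where
  "Tpair A B a b = inv_of C (chi C A B) \<cdot> \<langle>a, b\<rangle>"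

lemma chi_props:
  assumes "A \<in> Ob C" "B \<in> Ob C"
  shows "chi C A B \<in> Ar C" "Dom C (chi C A B) = Tob C (A \<otimes> B)" "Cod C (chi C A B) = Tob C A \<otimes> Tob C B"
    "inv_of C (chi C A B) \<in> Ar C" "Dom C (inv_of C (chi C A B)) = Tob C A \<otimes> Tob C B"
    "Cod C (inv_of C (chi C A B)) = Tob C (A \<otimes> B)"
    "inv_of C (chi C A B) \<cdot> chi C A B = Idn C (Tob C (A \<otimes> B))"
    "chi C A B \<cdot> inv_of C (chi C A B) = Idn C (Tob C A \<otimes> Tob C B)"
  using is_inverse_inv_of[OF chi_iso[OF assms]] assms
  by (auto simp: is_inverse_def Hom_def chi_def)

text \<open>Since \<open>chi\<close> is invertible, the tangent maps of the projections make
  \<open>Tob C (A \<otimes> B)\<close> a product again, and in particular are jointly monic.\<close>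

lemma Tprod_eqI:
  assumes "A \<in> Ob C" "B \<in> Ob C" "z \<in> Ar C" "z' \<in> Ar C" "Dom C z = Dom C z'"
    "Cod C z = Tob C (A \<otimes> B)" "Cod C z' = Tob C (A \<otimes> B)"
    "Tar C (pr1 C A B) \<cdot> z = Tar C (pr1 C A B) \<cdot> z'" "Tar C (pr2 C A B) \<cdot> z = Tar C (pr2 C A B) \<cdot> z'"
  shows "z = z'"
proof -
  note c = chi_props[OF assms(1,2)]
  have "chi C A B \<cdot> z = chi C A B \<cdot> z'" using assms by (simp add: chi_def)
  hence "inv_of C (chi C A B) \<cdot> (chi C A B \<cdot> z) = inv_of C (chi C A B) \<cdot> (chi C A B \<cdot> z')" by simp
  thus ?thesis
    using comp_eq_comp[OF c(7), of z] comp_eq_comp[OF c(7), of z'] c assms(1-7) by simp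
qed

lemma Tpair_simps [simp]:
  assumes "A \<in> Ob C" "B \<in> Ob C" "a \<in> Ar C" "b \<in> Ar C" "Dom C a = Dom C b"
    "Cod C a = Tob C A" "Cod C b = Tob C B"
  shows "Tpair A B a b \<in> Ar C" "Dom C (Tpair A B a b) = Dom C b" "Cod C (Tpair A B a b) = Tob C (A \<otimes> B)"
    "Tar C (pr1 C A B) \<cdot> Tpair A B a b = a" "Tar C (pr2 C A B) \<cdot> Tpair A B a b = b"
proof -
  note c = chi_props[OF assms(1,2)]
  show t: "Tpair A B a b \<in> Ar C" "Dom C (Tpair A B a b) = Dom C b" "Cod C (Tpair A B a b) = Tob C (A \<otimes> B)"
    using c assms by (simp_all add: Tpair_def)
  have "chi C A B \<cdot> Tpair A B a b = \<langle>a, b\<rangle>"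
    unfolding Tpair_def using comp_eq_comp[OF c(8), of "\<langle>a, b\<rangle>"] c assms by simp
  hence e: "\<langle>Tar C (pr1 C A B) \<cdot> Tpair A B a b, Tar C (pr2 C A B) \<cdot> Tpair A B a b\<rangle> = \<langle>a, b\<rangle>"
    using t assms by (simp add: chi_def)
  from arg_cong[OF e, of "(\<cdot>) (pr1 C (Tob C A) (Tob C B))"] show "Tar C (pr1 C A B) \<cdot> Tpair A B a b = a"
    using t assms by simp
  from arg_cong[OF e, of "(\<cdot>) (pr2 C (Tob C A) (Tob C B))"] show "Tar C (pr2 C A B) \<cdot> Tpair A B a b = b"
    using t assms by simp
qed

lemma proj_Tpair:
  assumes "A \<in> Ob C" "B \<in> Ob C" "a \<in> Ar C" "b \<in> Ar C" "Dom C a = Dom C b"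
    "Cod C a = Tob C A" "Cod C b = Tob C B"
  shows "\<pi> (A \<otimes> B) \<cdot> Tpair A B a b = \<langle>\<pi> A \<cdot> a, \<pi> B \<cdot> b\<rangle>"
proof (rule prod_eqI[OF assms(1,2)])
  show "pr1 C A B \<cdot> (\<pi> (A \<otimes> B) \<cdot> Tpair A B a b) = pr1 C A B \<cdot> \<langle>\<pi> A \<cdot> a, \<pi> B \<cdot> b\<rangle>"
    using proj_Tar[of "pr1 C A B" "Tpair A B a b" A] assms by simp
  show "pr2 C A B \<cdot> (\<pi> (A \<otimes> B) \<cdot> Tpair A B a b) = pr2 C A B \<cdot> \<langle>\<pi> A \<cdot> a, \<pi> B \<cdot> b\<rangle>"
    using proj_Tar[of "pr2 C A B" "Tpair A B a b" B] assms by simp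
qed (use assms in simp_all)

lemma Tar_pair:
  assumes "f \<in> Ar C" "g \<in> Ar C" "Dom C f = Dom C g" "v \<in> Ar C" "Cod C v = Tob C (Dom C g)"
    "Cod C f = A" "Cod C g = B"
  shows "Tar C \<langle>f, g\<rangle> \<cdot> v = Tpair A B (Tar C f \<cdot> v) (Tar C g \<cdot> v)"
proof (rule Tprod_eqI[of A B])
  have "Tar C (pr1 C A B) \<cdot> Tar C \<langle>f, g\<rangle> = Tar C f" "Tar C (pr2 C A B) \<cdot> Tar C \<langle>f, g\<rangle> = Tar C g"
    using assms Tar_comp_arr[of "\<langle>f, g\<rangle>" "pr1 C A B"] Tar_comp_arr[of "\<langle>f, g\<rangle>" "pr2 C A B"] by auto
  from this[THEN comp_eq_comp, of v] show
    "Tar C (pr1 C A B) \<cdot> (Tar C \<langle>f, g\<rangle> \<cdot> v) = Tar C (pr1 C A B) \<cdot> Tpair A B (Tar C f \<cdot> v) (Tar C g \<cdot> v)"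
    "Tar C (pr2 C A B) \<cdot> (Tar C \<langle>f, g\<rangle> \<cdot> v) = Tar C (pr2 C A B) \<cdot> Tpair A B (Tar C f \<cdot> v) (Tar C g \<cdot> v)"
    using assms by auto
qed (use assms in auto)

lemma same_fiber_Tpair:
  assumes "same_fiber A a a'" "same_fiber B b b'" "Dom C a = Dom C b"
  shows "same_fiber (A \<otimes> B) (Tpair A B a b) (Tpair A B a' b')"
  using same_fiberD[OF assms(1)] same_fiberD[OF assms(2)] assms(3)
  by (simp add: same_fiber_def proj_Tpair)

text \<open>Addition on the tangent bundle of a product is componentwise because tangent maps of the
  projections are additive by naturality.\<close>

lemma Tpair_vf_add:
  assumes "same_fiber A a a'" "same_fiber B b b'" "Dom C a = Dom C b"
  shows "Tpair A B (vf_add C A a a') (vf_add C B b b')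
    = vf_add C (A \<otimes> B) (Tpair A B a b) (Tpair A B a' b')"
proof -
  note D = same_fiberD[OF assms(1)] same_fiberD[OF assms(2)]
  note s = same_fiber_Tpair[OF assms]
  note t = vf_add_typing[OF assms(1)] vf_add_typing[OF assms(2)] vf_add_typing[OF s]
  show ?thesis
  proof (rule Tprod_eqI[OF D(1) D(8)])
    show "Tar C (pr1 C A B) \<cdot> Tpair A B (vf_add C A a a') (vf_add C B b b')
      = Tar C (pr1 C A B) \<cdot> vf_add C (A \<otimes> B) (Tpair A B a b) (Tpair A B a' b')"
      using Tar_vf_add[of "pr1 C A B" "Tpair A B a b" "Tpair A B a' b'" A] D s t assms by simp
    show "Tar C (pr2 C A B) \<cdot> Tpair A B (vf_add C A a a') (vf_add C B b b')
      = Tar C (pr2 C A B) \<cdot> vf_add C (A \<otimes> B) (Tpair A B a b) (Tpair A B a' b')"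
      using Tar_vf_add[of "pr2 C A B" "Tpair A B a b" "Tpair A B a' b'" B] D s t assms by simp
  qed (use D t assms in simp_all)
qed

section \<open>Partial tangent morphisms\<close>

lemma partial_T1_pair:
  assumes "f \<in> Ar C" "Dom C f = A \<otimes> B" "A \<in> Ob C" "B \<in> Ob C" "a \<in> Ar C" "b \<in> Ar C"
    "Dom C a = Dom C b" "Cod C a = Tob C A" "Cod C b = B"
  shows "partial_T1 C A B f \<cdot> \<langle>a, b\<rangle> = Tar C f \<cdot> Tpair A B a (\<zeta> B \<cdot> b)"
  using assms chi_props[OF assms(3,4)] by (simp add: partial_T1_def Tpair_def)

lemma partial_T2_pair:
  assumes "f \<in> Ar C" "Dom C f = A \<otimes> B" "A \<in> Ob C" "B \<in> Ob C" "a \<in> Ar C" "b \<in> Ar C"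
    "Dom C a = Dom C b" "Cod C a = A" "Cod C b = Tob C B"
  shows "partial_T2 C A B f \<cdot> \<langle>a, b\<rangle> = Tar C f \<cdot> Tpair A B (\<zeta> A \<cdot> a) b"
  using assms chi_props[OF assms(3,4)] by (simp add: partial_T2_def Tpair_def)

text \<open>The tangent vector (a, b) is (a, 0) + (0, b) with zeros over the respective base points,
  and \<open>Tar C f\<close> is additive: the total derivative is the sum of the partial
  ones.\<close>

lemma Tar_Tpair_partials:
  assumes "f \<in> Ar C" "Dom C f = A \<otimes> B" "Cod C f = Y" "A \<in> Ob C" "B \<in> Ob C" "a \<in> Ar C" "b \<in> Ar C"
    "Dom C a = Dom C b" "Cod C a = Tob C A" "Cod C b = Tob C B"
  shows "same_fiber Y (partial_T1 C A B f \<cdot> \<langle>a, \<pi> B \<cdot> b\<rangle>) (partial_T2 C A B f \<cdot> \<langle>\<pi> A \<cdot> a, b\<rangle>)"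
    "Tar C f \<cdot> Tpair A B a b =
      vf_add C Y (partial_T1 C A B f \<cdot> \<langle>a, \<pi> B \<cdot> b\<rangle>) (partial_T2 C A B f \<cdot> \<langle>\<pi> A \<cdot> a, b\<rangle>)"
proof -
  have sa: "same_fiber A a (\<zeta> A \<cdot> (\<pi> A \<cdot> a))" and sb: "same_fiber B (\<zeta> B \<cdot> (\<pi> B \<cdot> b)) b"
    using same_fiber_zero same_fiber_sym assms by auto
  have s: "same_fiber (A \<otimes> B) (Tpair A B a (\<zeta> B \<cdot> (\<pi> B \<cdot> b))) (Tpair A B (\<zeta> A \<cdot> (\<pi> A \<cdot> a)) b)"
    by (rule same_fiber_Tpair[OF sa sb]) (use assms in simp)
  have e: "partial_T1 C A B f \<cdot> \<langle>a, \<pi> B \<cdot> b\<rangle> = Tar C f \<cdot> Tpair A B a (\<zeta> B \<cdot> (\<pi> B \<cdot> b))"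
    "partial_T2 C A B f \<cdot> \<langle>\<pi> A \<cdot> a, b\<rangle> = Tar C f \<cdot> Tpair A B (\<zeta> A \<cdot> (\<pi> A \<cdot> a)) b"
    using assms by (simp_all add: partial_T1_pair partial_T2_pair)
  show "same_fiber Y (partial_T1 C A B f \<cdot> \<langle>a, \<pi> B \<cdot> b\<rangle>) (partial_T2 C A B f \<cdot> \<langle>\<pi> A \<cdot> a, b\<rangle>)"
    unfolding e using same_fiber_Tar s assms by simp
  have "vf_add C A a (\<zeta> A \<cdot> (\<pi> A \<cdot> a)) = a"
    using vf_add_zero_right[of A a a] assms by (simp add: same_fiber_def)
  moreover have "vf_add C B (\<zeta> B \<cdot> (\<pi> B \<cdot> b)) b = b" using vf_add_zero_left assms by simp
  ultimately have "Tpair A B a b =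
    vf_add C (A \<otimes> B) (Tpair A B a (\<zeta> B \<cdot> (\<pi> B \<cdot> b))) (Tpair A B (\<zeta> A \<cdot> (\<pi> A \<cdot> a)) b)"
    using Tpair_vf_add[OF sa sb] assms by simp
  thus "Tar C f \<cdot> Tpair A B a b =
      vf_add C Y (partial_T1 C A B f \<cdot> \<langle>a, \<pi> B \<cdot> b\<rangle>) (partial_T2 C A B f \<cdot> \<langle>\<pi> A \<cdot> a, b\<rangle>)"
    unfolding e using Tar_vf_add[of f _ _ Y] s assms by simp
qed

text \<open>In (0, b) + (0, b') the first components are zeros over the same point \<open>a\<close>,
  and zero plus zero is zero.\<close>

lemma partial_T2_vf_add:
  assumes "f \<in> Ar C" "Dom C f = A \<otimes> B" "Cod C f = Y" "A \<in> Ob C" "a \<in> Ar C" "Cod C a = A"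
    "same_fiber B b b'" "Dom C a = Dom C b"
  shows "same_fiber Y (partial_T2 C A B f \<cdot> \<langle>a, b\<rangle>) (partial_T2 C A B f \<cdot> \<langle>a, b'\<rangle>)"
    "partial_T2 C A B f \<cdot> \<langle>a, vf_add C B b b'\<rangle> =
      vf_add C Y (partial_T2 C A B f \<cdot> \<langle>a, b\<rangle>) (partial_T2 C A B f \<cdot> \<langle>a, b'\<rangle>)"
proof -
  note D = same_fiberD[OF assms(7)]
  note t = vf_add_typing[OF assms(7)]
  have sa: "same_fiber A (\<zeta> A \<cdot> a) (\<zeta> A \<cdot> a)" using assms by (simp add: same_fiber_def)
  have s: "same_fiber (A \<otimes> B) (Tpair A B (\<zeta> A \<cdot> a) b) (Tpair A B (\<zeta> A \<cdot> a) b')"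
    by (rule same_fiber_Tpair[OF sa assms(7)]) (use assms in simp)
  have e: "partial_T2 C A B f \<cdot> \<langle>a, x\<rangle> = Tar C f \<cdot> Tpair A B (\<zeta> A \<cdot> a) x"
    if "x \<in> Ar C" "Dom C x = Dom C b" "Cod C x = Tob C B" for x
    using that assms D(1) by (simp add: partial_T2_pair)
  have za: "vf_add C A (\<zeta> A \<cdot> a) (\<zeta> A \<cdot> a) = \<zeta> A \<cdot> a"
    using vf_add_zero_right[OF sa] assms by (simp add: proj_zero)
  show "same_fiber Y (partial_T2 C A B f \<cdot> \<langle>a, b\<rangle>) (partial_T2 C A B f \<cdot> \<langle>a, b'\<rangle>)"
    using same_fiber_Tar[of f _ _ Y] s assms D by (simp add: e)
  have "Tpair A B (\<zeta> A \<cdot> a) (vf_add C B b b') =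
    vf_add C (A \<otimes> B) (Tpair A B (\<zeta> A \<cdot> a) b) (Tpair A B (\<zeta> A \<cdot> a) b')"
    using Tpair_vf_add[OF sa assms(7)] za assms by simp
  thus "partial_T2 C A B f \<cdot> \<langle>a, vf_add C B b b'\<rangle> =
      vf_add C Y (partial_T2 C A B f \<cdot> \<langle>a, b\<rangle>) (partial_T2 C A B f \<cdot> \<langle>a, b'\<rangle>)"
    using Tar_vf_add[of f _ _ Y] s assms D t by (simp add: e)
qed

end

section \<open>Scalar multiplication\<close>

context scalar_tangent_category
begin

abbreviation (input) R :: 'o where "R \<equiv> Rg C"

lemma ring_simps [simp]:
  shows "R \<in> Ob C"
    "ring_add C \<in> Ar C" "Dom C (ring_add C) = R \<otimes> R" "Cod C (ring_add C) = R"
    "ring_zero C \<in> Ar C" "Dom C (ring_zero C) = One C" "Cod C (ring_zero C) = R"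
proof -
  have "R \<in> Ob C" "ring_add C \<in> Hom C (R \<otimes> R) R" "ring_zero C \<in> Hom C (One C) R"
    using ring_object unfolding comm_ring_object_def Let_def by blast+
  thus "R \<in> Ob C"
    "ring_add C \<in> Ar C" "Dom C (ring_add C) = R \<otimes> R" "Cod C (ring_add C) = R"
    "ring_zero C \<in> Ar C" "Dom C (ring_zero C) = One C" "Cod C (ring_zero C) = R"
    by (auto simp: Hom_def)
qed

section \<open>The additive group of the ring object and the projection \<open>eta\<close>\<close>

lemma radd_assoc:
  assumes "x \<in> Ar C" "y \<in> Ar C" "z \<in> Ar C" "Dom C x = Dom C z" "Dom C y = Dom C z"
    "Cod C x = R" "Cod C y = R" "Cod C z = R"
  shows "ring_add C \<cdot> \<langle>ring_add C \<cdot> \<langle>x, y\<rangle>, z\<rangle> = ring_add C \<cdot> \<langle>x, ring_add C \<cdot> \<langle>y, z\<rangle>\<rangle>"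
proof -
  let ?a = "ring_add C" and ?x = "pr1_3 C R R R" and ?y = "pr2_3 C R R R" and ?z = "pr3_3 C R R R"
  have ax: "?a \<cdot> \<langle>?a \<cdot> \<langle>?x, ?y\<rangle>, ?z\<rangle> = ?a \<cdot> \<langle>?x, ?a \<cdot> \<langle>?y, ?z\<rangle>\<rangle>"
    using ring_object unfolding comm_ring_object_def Let_def by blast
  have "(?a \<cdot> \<langle>?a \<cdot> \<langle>?x, ?y\<rangle>, ?z\<rangle>) \<cdot> \<langle>\<langle>x, y\<rangle>, z\<rangle> = (?a \<cdot> \<langle>?x, ?a \<cdot> \<langle>?y, ?z\<rangle>\<rangle>) \<cdot> \<langle>\<langle>x, y\<rangle>, z\<rangle>"
    by (simp only: ax)
  thus ?thesis using assms by (simp add: pr1_3_def pr2_3_def pr3_3_def)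
qed

lemma radd_commute:
  assumes "x \<in> Ar C" "y \<in> Ar C" "Dom C x = Dom C y" "Cod C x = R" "Cod C y = R"
  shows "ring_add C \<cdot> \<langle>x, y\<rangle> = ring_add C \<cdot> \<langle>y, x\<rangle>"
proof -
  have ax: "ring_add C \<cdot> \<langle>pr2 C R R, pr1 C R R\<rangle> = ring_add C"
    using ring_object unfolding comm_ring_object_def Let_def by blast
  have "ring_add C \<cdot> \<langle>x, y\<rangle> = (ring_add C \<cdot> \<langle>pr2 C R R, pr1 C R R\<rangle>) \<cdot> \<langle>x, y\<rangle>"
    by (simp only: ax)
  also have "\<dots> = ring_add C \<cdot> \<langle>y, x\<rangle>" using assms by simp
  finally show ?thesis .
qed

lemma radd_zero_left:
  assumes "x \<in> Ar C" "Cod C x = R"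
  shows "ring_add C \<cdot> \<langle>ring_zero C \<cdot> to_One C (Dom C x), x\<rangle> = x"
proof -
  have ax: "ring_add C \<cdot> \<langle>ring_zero C \<cdot> to_One C R, Idn C R\<rangle> = Idn C R"
    using ring_object unfolding comm_ring_object_def Let_def by blast
  from comp_eq_comp[OF this, of x] show ?thesis using assms by (simp add: to_One_comp)
qed

text \<open>Only existence is an axiom. Uniqueness is the usual argument m = (n + x) + m = n + (x +
  m) = n at the generic point x of the ring.\<close>

lemma is_ring_neg_ring_neg: "is_ring_neg C (ring_neg C)"
proof -
  let ?a = "ring_add C" and ?I = "Idn C R"
  let ?z = "ring_zero C \<cdot> to_One C R"
  obtain n where n: "is_ring_neg C n"
    using ring_object unfolding comm_ring_object_def Let_def by blast
  have "m = n" if m: "is_ring_neg C m" for m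
  proof -
    have t: "m \<in> Ar C" "Dom C m = R" "Cod C m = R" "n \<in> Ar C" "Dom C n = R" "Cod C n = R"
      and e: "?a \<cdot> \<langle>m, ?I\<rangle> = ?z" "?a \<cdot> \<langle>n, ?I\<rangle> = ?z"
      using m n by (auto simp: is_ring_neg_def Hom_def)
    have "m = ?a \<cdot> \<langle>?z, m\<rangle>" using radd_zero_left[of m] t by simp
    also have "\<dots> = ?a \<cdot> \<langle>n, ?a \<cdot> \<langle>?I, m\<rangle>\<rangle>"
      using radd_assoc[of n ?I m] t e by simp
    also have "?a \<cdot> \<langle>?I, m\<rangle> = ?z" using radd_commute[of ?I m] t e by simp
    also have "?a \<cdot> \<langle>n, ?z\<rangle> = n"
      using radd_commute[of n ?z] radd_zero_left[of n] t by simp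
    finally show ?thesis .
  qed
  thus ?thesis unfolding ring_neg_def using n by (metis theI)
qed

text \<open>Even the typing of \<open>eta\<close> has content, since its definition is a
  description. Translating a tangent vector at x by -x moves its base point to zero, so the
  translate factors through the fiber \<open>T0R\<close>.\<close>

lemma eta_simps [simp]:
  shows "eta C \<in> Ar C" "Dom C (eta C) = Tob C R" "Cod C (eta C) = R"
proof -
  let ?n = "ring_neg C" and ?I = "Idn C (Tob C R)"
  have n: "?n \<in> Ar C" "Dom C ?n = R" "Cod C ?n = R" "ring_add C \<cdot> \<langle>?n, Idn C R\<rangle> = ring_zero C \<cdot> to_One C R"
    using is_ring_neg_ring_neg by (auto simp: is_ring_neg_def Hom_def)
  define y where "y = partial_T2 C R R (ring_add C) \<cdot> \<langle>?n \<cdot> \<pi> R, ?I\<rangle>"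
  have y: "y = Tar C (ring_add C) \<cdot> Tpair R R (\<zeta> R \<cdot> (?n \<cdot> \<pi> R)) ?I"
    unfolding y_def using n by (simp add: partial_T2_pair)
  have "\<pi> R \<cdot> y = ring_add C \<cdot> \<langle>?n \<cdot> \<pi> R, \<pi> R\<rangle>"
    using n by (simp add: y proj_Tar proj_Tpair proj_zero)
  also have "\<dots> = ring_zero C \<cdot> to_One C (Tob C R)"
    using comp_eq_comp[OF n(4), of "\<pi> R"] n by (simp add: to_One_comp)
  finally have py: "ring_zero C \<cdot> to_One C (Tob C R) = \<pi> R \<cdot> y" by simp
  have pb: "is_pullback C (ring_zero C) (\<pi> R) (T0R C) (to_One C (T0R C)) (T0R_incl C)"
    and i: "T0R_iso C \<in> Hom C (T0R C) R"
    using stable unfolding tangent_stable_def by blast+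
  have "y \<in> Hom C (Tob C R) (Tob C R)" using n by (simp add: y Hom_def)
  hence "\<exists>!u. u \<in> Hom C (Tob C R) (T0R C) \<and> to_One C (T0R C) \<cdot> u = to_One C (Tob C R) \<and> T0R_incl C \<cdot> u = y"
    by (intro pullback_lift[OF pb _ _ py]) (simp_all add: Hom_def)
  moreover have "to_One C (T0R C) \<cdot> u = to_One C (Tob C R)" if "u \<in> Hom C (Tob C R) (T0R C)" for u
    using to_One_comp[of u "T0R C"] that by (simp add: Hom_def)
  \<comment> \<open>The leg into the terminal object is automatic, so exactly the description in
    \<open>eta\<close> is left.\<close>
  ultimately have "\<exists>!u. u \<in> Hom C (Tob C R) (T0R C) \<and> T0R_incl C \<cdot> u = y" by blast
  from theI'[OF this] show "eta C \<in> Ar C" "Dom C (eta C) = Tob C R" "Cod C (eta C) = R"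
    using i unfolding eta_def y_def by (auto simp: Hom_def)
qed

section \<open>Scaling points of tangent bundles\<close>

lemma module_axioms:
  shows "X \<in> Ob C \<Longrightarrow> \<kappa> X \<in> Hom C (R \<otimes> Tob C X) (Tob C X)"
    "f \<in> Hom C X Y \<Longrightarrow> \<kappa> Y \<cdot> prod_map C (Idn C R) (Tar C f) = Tar C f \<cdot> \<kappa> X"
    "X \<in> Ob C \<Longrightarrow> \<pi> X \<cdot> \<kappa> X = \<pi> X \<cdot> pr2 C R (Tob C X)"
    "X \<in> Ob C \<Longrightarrow> \<kappa> X \<cdot> prod_map C (Idn C R) (\<alpha> X)
        = vf_add C X
            (\<kappa> X \<cdot> \<langle>pr1 C R (Tpow C 2 X), Tpr C 2 X 0 \<cdot> pr2 C R (Tpow C 2 X)\<rangle>)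
            (\<kappa> X \<cdot> \<langle>pr1 C R (Tpow C 2 X), Tpr C 2 X 1 \<cdot> pr2 C R (Tpow C 2 X)\<rangle>)"
  using module unfolding tangent_module_def Let_def vf_add_def by blast+

lemma scalar_simps [simp]:
  assumes "X \<in> Ob C"
  shows "\<kappa> X \<in> Ar C" "Dom C (\<kappa> X) = R \<otimes> Tob C X" "Cod C (\<kappa> X) = Tob C X"
  using module_axioms(1)[OF assms] by (auto simp: Hom_def)

lemma fun_scale_simps [simp]:
  assumes "X \<in> Ob C" "f \<in> Ar C" "x \<in> Ar C" "Dom C f = Dom C x" "Cod C f = R" "Cod C x = Tob C X"
  shows "fun_scale C X f x \<in> Ar C" "Dom C (fun_scale C X f x) = Dom C x" "Cod C (fun_scale C X f x) = Tob C X"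
  using assms by (simp_all add: fun_scale_def)

lemma proj_fun_scale:
  assumes "X \<in> Ob C" "f \<in> Ar C" "x \<in> Ar C" "Dom C f = Dom C x" "Cod C f = R" "Cod C x = Tob C X"
  shows "\<pi> X \<cdot> fun_scale C X f x = \<pi> X \<cdot> x"
  unfolding fun_scale_def
  using comp_eq_comp[OF module_axioms(3)[OF assms(1)], of "\<langle>f, x\<rangle>"] assms by simp

lemma same_fiber_fun_scale:
  assumes "same_fiber X x y" "f \<in> Ar C" "g \<in> Ar C" "Dom C f = Dom C x" "Dom C g = Dom C x"
    "Cod C f = R" "Cod C g = R"
  shows "same_fiber X (fun_scale C X f x) (fun_scale C X g y)"
  using same_fiberD[OF assms(1)] assms(2-) by (simp add: same_fiber_def proj_fun_scale)

lemma Tar_fun_scale: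
  assumes "h \<in> Ar C" "f \<in> Ar C" "x \<in> Ar C" "Dom C f = Dom C x" "Cod C f = R"
    "Cod C x = Tob C (Dom C h)" "Cod C h = Y"
  shows "Tar C h \<cdot> fun_scale C (Dom C h) f x = fun_scale C Y f (Tar C h \<cdot> x)"
proof -
  have "\<kappa> Y \<cdot> prod_map C (Idn C R) (Tar C h) = Tar C h \<cdot> \<kappa> (Dom C h)"
    using module_axioms(2)[of h "Dom C h" Y] assms by (simp add: Hom_def)
  moreover have "Y \<in> Ob C" using assms by auto
  ultimately show ?thesis unfolding fun_scale_def
    using comp_eq_comp[of "\<kappa> Y" "prod_map C (Idn C R) (Tar C h)" "Tar C h \<cdot> \<kappa> (Dom C h)" "\<langle>f, x\<rangle>"] assms
    by simp
qed

lemma fun_scale_vf_add: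
  assumes "same_fiber X x y" "f \<in> Ar C" "Dom C f = Dom C x" "Cod C f = R"
  shows "fun_scale C X f (vf_add C X x y) = vf_add C X (fun_scale C X f x) (fun_scale C X f y)"
proof -
  note P = tpair_props[OF assms(1)] same_fiberD[OF assms(1)]
  let ?X2 = "Tpow C 2 X"
  have X2: "?X2 \<in> Ob C" using P(6) Tpow_simps(1)[of X 0 2] by simp
  have s: "same_fiber X (Tpr C 2 X 0) (Tpr C 2 X 1)"
    using P(6) proj_Tpr[of X 0 2 1] by (auto simp: same_fiber_def)
  have sf: "same_fiber X (\<kappa> X \<cdot> \<langle>pr1 C R ?X2, Tpr C 2 X 0 \<cdot> pr2 C R ?X2\<rangle>)
      (\<kappa> X \<cdot> \<langle>pr1 C R ?X2, Tpr C 2 X 1 \<cdot> pr2 C R ?X2\<rangle>)"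
    unfolding fun_scale_def[symmetric]
    by (rule same_fiber_fun_scale, rule same_fiber_comp[OF s]) (use P(6) X2 in simp_all)
  have "fun_scale C X f (vf_add C X x y) = (\<kappa> X \<cdot> prod_map C (Idn C R) (\<alpha> X)) \<cdot> \<langle>f, tpair C X x y\<rangle>"
    unfolding fun_scale_def vf_add_def using P assms by simp
  also have "\<dots> = vf_add C X (fun_scale C X f x) (fun_scale C X f y)"
    unfolding module_axioms(4)[OF P(6)]
    by (subst vf_add_comp[OF sf]) (use P assms X2 in \<open>simp_all add: fun_scale_def\<close>)
  finally show ?thesis .
qed

lemma lift_fun_scale:
  assumes "X \<in> Ob C" "f \<in> Ar C" "x \<in> Ar C" "Dom C f = Dom C x" "Cod C f = R" "Cod C x = Tob C X"
  shows "\<ell> X \<cdot> fun_scale C X f x = fun_scale C (Tob C X) f (\<ell> X \<cdot> x)"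
  unfolding fun_scale_def
  using comp_eq_comp[OF S1[OF assms(1)], of "\<langle>f, x\<rangle>"] assms by simp

section \<open>Partial tangent morphisms of the scalar multiplication\<close>

text \<open>(S2) at a point. Here \<open>\<pi> R \<cdot> a\<close> and
  \<open>eta C \<cdot> a\<close> are the base point and the fiber part of a tangent vector of the
  ring; for \<open>a = Tar C f \<cdot> v\<close> they become \<open>f\<close> and
  \<open>vf_action C v f\<close>.\<close>

lemma partial_T1_scalar:
  assumes "X \<in> Ob C" "a \<in> Ar C" "x \<in> Ar C" "Dom C a = Dom C x" "Cod C a = Tob C R" "Cod C x = Tob C X"
  shows "partial_T1 C R (Tob C X) (\<kappa> X) \<cdot> \<langle>a, x\<rangle> =
    vert_lift2 C X \<cdot> tpair C X (fun_scale C X (\<pi> R \<cdot> a) x) (fun_scale C X (eta C \<cdot> a) x)"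
proof -
  let ?TX = "Tob C X"
  let ?u = "\<kappa> X \<cdot> \<langle>pr1_3 C R R ?TX, pr3_3 C R R ?TX\<rangle>" and ?w = "\<kappa> X \<cdot> \<langle>pr2_3 C R R ?TX, pr3_3 C R R ?TX\<rangle>"
  have sp: "same_fiber X (pr3_3 C R R ?TX) (pr3_3 C R R ?TX)"
    using assms(1) by (simp add: same_fiber_def pr3_3_def)
  have s: "same_fiber X ?u ?w"
    unfolding fun_scale_def[symmetric]
    by (rule same_fiber_fun_scale[OF sp]) (use assms(1) in \<open>simp_all add: pr1_3_def pr2_3_def pr3_3_def\<close>)
  have l: "vert_lift2 C X \<in> Ar C" "Dom C (vert_lift2 C X) = Tpow C 2 X"
  proof -
    have s: "same_fiber X (Tpr C 2 X 0) (Tpr C 2 X 1)"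
      using assms(1) proj_Tpr[of X 0 2 1] by (auto simp: same_fiber_def)
    show "vert_lift2 C X \<in> Ar C" "Dom C (vert_lift2 C X) = Tpow C 2 X"
      using vf_add_typing[OF same_fiber_lift2[OF s]] assms(1)
      by (simp_all add: vert_lift2_def flip: vf_add_def)
  qed
  let ?q = "\<langle>\<langle>\<pi> R \<cdot> a, eta C \<cdot> a\<rangle>, x\<rangle>"
  have "partial_T1 C R ?TX (\<kappa> X) \<cdot> \<langle>a, x\<rangle> = vert_lift2 C X \<cdot> (tpair C X ?u ?w \<cdot> ?q)"
    unfolding S2[OF assms(1)] using assms tpair_props[OF s] l by (simp add: pr1_3_def pr3_3_def)
  also have "tpair C X ?u ?w \<cdot> ?q = tpair C X (fun_scale C X (\<pi> R \<cdot> a) x) (fun_scale C X (eta C \<cdot> a) x)"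
    by (subst tpair_comp[OF s])
      (use assms in \<open>simp_all add: fun_scale_def pr1_3_def pr2_3_def pr3_3_def\<close>)
  finally show ?thesis .
qed

lemma partial_T2_scalar:
  assumes "X \<in> Ob C" "f \<in> Ar C" "x \<in> Ar C" "Dom C f = Dom C x" "Cod C f = R" "Cod C x = Tob C (Tob C X)"
  shows "partial_T2 C R (Tob C X) (\<kappa> X) \<cdot> \<langle>f, x\<rangle> = \<tau> X \<cdot> fun_scale C (Tob C X) f (\<tau> X \<cdot> x)"
  unfolding S3[OF assms(1)] using assms by (simp add: fun_scale_def)

text \<open>Two flips cancel. Scaling then distributes over the sum, passes
  \<open>Tar C (\<zeta> X)\<close> by naturality of \<kappa>, and passes \<ell> by (S1).\<close>

lemma partial_T2_scalar_lift2:
  assumes "same_fiber X x u" "f \<in> Ar C" "Dom C f = Dom C x" "Cod C f = R"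
  shows "partial_T2 C R (Tob C X) (\<kappa> X) \<cdot> \<langle>f, vert_lift2 C X \<cdot> tpair C X x u\<rangle> =
    vert_lift2 C X \<cdot> tpair C X (fun_scale C X f x) (fun_scale C X f u)"
proof -
  note D = same_fiberD[OF assms(1)]
  note s = same_fiber_lift2[OF assms(1)]
  have sf: "same_fiber X (fun_scale C X f x) (fun_scale C X f u)"
    using same_fiber_fun_scale assms by simp
  have "partial_T2 C R (Tob C X) (\<kappa> X) \<cdot> \<langle>f, vert_lift2 C X \<cdot> tpair C X x u\<rangle> =
    \<tau> X \<cdot> fun_scale C (Tob C X) f (vf_add C (Tob C X) (Tar C (\<zeta> X) \<cdot> x) (\<ell> X \<cdot> u))"
    using vf_add_typing[OF s] assms D
    by (simp add: partial_T2_scalar vert_lift2_tpair flip_flip_comp)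
  also have "\<dots> = \<tau> X \<cdot> vf_add C (Tob C X) (Tar C (\<zeta> X) \<cdot> fun_scale C X f x) (\<ell> X \<cdot> fun_scale C X f u)"
    using fun_scale_vf_add[OF s, of f] Tar_fun_scale[of "\<zeta> X" f x "Tob C X"] lift_fun_scale[of X f u] assms D
    by simp
  also have "\<dots> = vert_lift2 C X \<cdot> tpair C X (fun_scale C X f x) (fun_scale C X f u)"
    by (simp add: vert_lift2_tpair[OF sf])
  finally show ?thesis .
qed

section \<open>The Leibniz rule\<close>

lemma fun_scale_vector_field:
  assumes "w \<in> vector_fields C X" "f \<in> Hom C X R"
  shows "fun_scale C X f w \<in> vector_fields C X"
  using vector_fieldsD[OF assms(1)] assms(2) by (simp add: vector_fields_def Hom_def proj_fun_scale)

lemma vf_add_vector_field: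
  assumes "v \<in> vector_fields C X" "w \<in> vector_fields C X"
  shows "vf_add C X v w \<in> vector_fields C X"
  using same_fiber_vector_fields[OF assms] vector_fieldsD[OF assms(1)]
  by (simp add: vector_fields_def Hom_def proj_vf_add)

theorem Leibniz_rule:
  assumes "v \<in> vector_fields C X" "w \<in> vector_fields C X" "f \<in> Hom C X R"
  shows "vf_bracket C X v (fun_scale C X f w) =
    vf_add C X (fun_scale C X (vf_action C v f) w) (fun_scale C X f (vf_bracket C X v w))"
proof -
  note V = vector_fieldsD[OF assms(1)] and W = vector_fieldsD[OF assms(2)]
  have f: "f \<in> Ar C" "Dom C f = X" "Cod C f = R" using assms(3) by (auto simp: Hom_def)
  let ?TX = "Tob C X" and ?fw = "fun_scale C X f w" and ?u = "vf_bracket C X v w"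
  let ?g = "vf_action C v f" and ?F = "\<lambda>x. partial_T2 C R (Tob C X) (\<kappa> X) \<cdot> \<langle>f, x\<rangle>"
  let ?d = "vf_delta C X v w" and ?y = "\<tau> X \<cdot> (Tar C v \<cdot> w)"
  let ?L = "vert_lift2 C X \<cdot> tpair C X ?fw (fun_scale C X ?g w)"
  have g: "?g \<in> Hom C X R" using f V by (simp add: vf_action_def Hom_def)
  have fw: "?fw \<in> vector_fields C X" and fu: "fun_scale C X f ?u \<in> vector_fields C X"
    and gw: "fun_scale C X ?g w \<in> vector_fields C X"
    using fun_scale_vector_field vf_bracket assms g by blast+
  note FW = vector_fieldsD[OF fw]
  note d = vf_delta[OF assms(1,2)]
  note sd = vf_delta[OF assms(1) fw]

  \<comment> \<open>The components of this tangent vector of a product have base points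
    \<open>f\<close> and \<open>w\<close>, which fixes where the two partial morphisms are
    evaluated.\<close>
  have "Tar C ?fw \<cdot> v = Tar C (\<kappa> X) \<cdot> Tpair R ?TX (Tar C f \<cdot> v) (Tar C w \<cdot> v)"
    using Tar_comp_arr[of "\<langle>f, w\<rangle>" "\<kappa> X"] Tar_pair[of f w v R ?TX] f V W by (simp add: fun_scale_def)
  moreover have "partial_T1 C R ?TX (\<kappa> X) \<cdot> \<langle>Tar C f \<cdot> v, \<pi> ?TX \<cdot> (Tar C w \<cdot> v)\<rangle> = ?L"
    using f V W by (simp add: partial_T1_scalar proj_Tar vf_action_def)
  moreover have "partial_T2 C R ?TX (\<kappa> X) \<cdot> \<langle>\<pi> R \<cdot> (Tar C f \<cdot> v), Tar C w \<cdot> v\<rangle> = ?F (Tar C w \<cdot> v)"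
    using f V W by (simp add: proj_Tar)
  ultimately have x': "Tar C ?fw \<cdot> v = vf_add C ?TX ?L (?F (Tar C w \<cdot> v))"
    and sL: "same_fiber ?TX ?L (?F (Tar C w \<cdot> v))"
    using Tar_Tpair_partials[of "\<kappa> X" R ?TX ?TX "Tar C f \<cdot> v" "Tar C w \<cdot> v"] f V W by simp_all

  have Fx: "?F (Tar C w \<cdot> v) = vf_add C ?TX (?F ?d) (?F ?y)" and sF: "same_fiber ?TX (?F ?d) (?F ?y)"
    using partial_T2_vf_add[of "\<kappa> X" R ?TX ?TX f ?d ?y] d same_fiberD[OF d(1)] f V W by simp_all
  have Fd: "?F ?d = vert_lift2 C X \<cdot> tpair C X ?fw (fun_scale C X f ?u)"
    unfolding vf_bracket(2)[OF assms(1,2)]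
    by (rule partial_T2_scalar_lift2)
      (use same_fiber_vector_fields vf_bracket assms f W in auto)
  \<comment> \<open>Both the flip inside \<open>?y\<close> and the inner one of (S3) cancel;
    naturality of \<kappa> along \<open>v\<close> then moves the scaling inside
    \<open>Tar C v\<close>.\<close>
  have Fy: "?F ?y = \<tau> X \<cdot> (Tar C v \<cdot> ?fw)"
    using Tar_fun_scale[of v f w ?TX] f V W by (simp add: partial_T2_scalar flip_flip_comp)

  have sLF: "same_fiber ?TX ?L (?F ?y)" "same_fiber ?TX ?L (?F ?d)"
  proof -
    have "same_fiber ?TX (?F (Tar C w \<cdot> v)) (?F ?y)"
      unfolding Fx by (rule same_fiber_vf_add(1)[OF sF]) (rule sF)
    thus "same_fiber ?TX ?L (?F ?y)" by (rule same_fiber_trans[OF sL])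
    thus "same_fiber ?TX ?L (?F ?d)" by (rule same_fiber_trans) (rule same_fiber_sym[OF sF])
  qed
  \<comment> \<open>Both sides equal \<open>Tar C ?fw \<cdot> v\<close>: the left by the equation
    for the difference, the right by regrouping the sum of partial derivatives. Then
    \<open>?F ?y\<close> is cancelled.\<close>
  have "vf_add C ?TX (vf_delta C X v ?fw) (?F ?y) = vf_add C ?TX (vf_add C ?TX ?L (?F ?d)) (?F ?y)"
    using sd(2) unfolding vf_add_assoc[OF sLF(2,1)] Fx[symmetric] x'[symmetric] by (simp only: Fy)
  hence "vf_delta C X v ?fw = vf_add C ?TX ?L (?F ?d)"
    by (rule vf_add_cancel[rotated 2]) (use sd Fy same_fiber_vf_add(1)[OF sLF(2,1)] in simp_all)
  also have "\<dots> = vert_lift2 C X \<cdot> tpair C X ?fw (vf_add C X (fun_scale C X ?g w) (fun_scale C X f ?u))"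
    unfolding Fd using vert_lift2_add same_fiber_vector_fields fw fu gw by blast
  finally show ?thesis
    by (rule vf_bracket_eqI[OF fw vf_add_vector_field[OF gw fu]])
qed

end

theorem proposition5p7:
  fixes C :: "('o, 'm) scalar_tangent_data" and X :: 'o and v w f :: 'm
  assumes "scalar_tangent_category C"
    and "X \<in> Ob C"
    and "v \<in> vector_fields C X" and "w \<in> vector_fields C X"
    and "f \<in> Hom C X (Rg C)"
  shows "vf_bracket C X v (fun_scale C X f w) =
    vf_add C X (fun_scale C X (vf_action C v f) w) (fun_scale C X f (vf_bracket C X v w))"
  by (rule scalar_tangent_category.Leibniz_rule[OF assms(1,3-5)])

end
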